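(* Let $x: M^n \to E^{n+1}$ be an isometric immersion of an $n$-dimensional Riemannian manifold $(M^n,g)$ as a hypersurface of the Euclidean space $E^{n+1}$. Suppose that $M^n$ is a biharmonic hypersurface and that the Jacobi operator $R_X$ is recurrent for any $X\in\Gamma(TM^n)$, i.e. there exists a $1$-form $\eta$ on $M^n$ such that $(\nabla_Y R_X)(Z)=\eta(Y)\,R_X(Z)$ for all vector fields $X,Y,Z$ tangent to $M^n$. Then $M^n$ is minimal.
   Context: $\nabla$ is the Levi-Civita connection of $(M^n,g)$ and $R$ its Riemann curvature tensor. For a vector field $X$ on $M^n$, the Jacobi operator $R_X$ is the $(1,1)$-tensor field $R_X(Z)=R(Z,X)X$, and $\nabla_Y R_X$ denotes the covariant derivative of this $(1,1)$-tensor field, i.e. $(\nabla_Y R_X)(Z)=\nabla_Y(R_X(Z))-R_X(\nabla_Y Z)$. Let $N$ be a local unit normal field, $A$ the shape (Weingarten) operator, and $\overrightarrow{H}=HN$ the mean curvature vector field, where $nH=\mathrm{trace}\,A$. The Laplacian is $\Delta=-\mathrm{trace}\,\nabla^2$, so that $\Delta x=-n\overrightarrow{H}$ (applied componentwise to $E^{n+1}$-valued functions). The hypersurface is biharmonic if $\Delta \overrightarrow{H}=0$; equivalently, $\Delta^{\perp}H+H\,\mathrm{trace}A^2=0$ and $2A(\mathrm{grad}\,H)+nH\,\mathrm{grad}\,H=0$, where $\Delta^{\perp}$ is the Laplacian in the normal bundle. Minimal means $H\equiv 0$. *)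

theory Defs
  imports "HOL-Analysis.Analysis"
begin

section \<open>Smooth maps between open subsets of normed spaces\<close>

text \<open>For open \<open>S\<close> in a finite-dimensional space: all iterated directional derivatives up to
  order \<open>k\<close> exist, those of order less than \<open>k\<close> are differentiable, those of order \<open>k\<close> continuous.\<close>

primrec Ck_on ::
  "nat \<Rightarrow> 'b::real_normed_vector set \<Rightarrow> ('b \<Rightarrow> 'c::real_normed_vector) \<Rightarrow> bool" where
  "Ck_on 0 S f \<longleftrightarrow> continuous_on S f"
| "Ck_on (Suc k) S f \<longleftrightarrow>
     (\<forall>y\<in>S. f differentiable (at y)) \<and>
     (\<forall>v. Ck_on k S (\<lambda>y. frechet_derivative f (at y) v))"

definition Cinf_on :: "'b::real_normed_vector set \<Rightarrow> ('b \<Rightarrow> 'c::real_normed_vector) \<Rightarrow> bool" where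
  "Cinf_on S f \<longleftrightarrow> (\<forall>k. Ck_on k S f)"


section \<open>Smooth manifolds\<close>

text \<open>The points of a manifold are \<open>topspace (mtop M)\<close>; values of functions outside this set are
  irrelevant throughout. A chart is a domain together with a coordinate map. The dimension of the
  manifold is the dimension of the model space \<open>'b\<close>.\<close>

record ('a, 'b) manifold =
  mtop :: "'a topology"
  charts :: "('a set \<times> ('a \<Rightarrow> 'b)) set"

definition points :: "('a, 'b::euclidean_space) manifold \<Rightarrow> 'a set" where
  "points M = topspace (mtop M)"

definition smooth_manifold :: "('a, 'b::euclidean_space) manifold \<Rightarrow> bool" where
  "smooth_manifold M \<longleftrightarrow>
     Hausdorff_space (mtop M) \<and> second_countable (mtop M) \<and>
     points M = (\<Union>(U, \<phi>)\<in>charts M. U) \<and>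
     (\<forall>(U, \<phi>)\<in>charts M. openin (mtop M) U \<and> open (\<phi> ` U) \<and>
        homeomorphic_map (subtopology (mtop M) U) (top_of_set (\<phi> ` U)) \<phi>) \<and>
     (\<forall>(U, \<phi>)\<in>charts M. \<forall>(V, \<psi>)\<in>charts M.
        Cinf_on (\<phi> ` (U \<inter> V)) (\<psi> \<circ> inv_into U \<phi>))"

definition smooth_fun_on ::
  "('a, 'b::euclidean_space) manifold \<Rightarrow> 'a set \<Rightarrow> ('a \<Rightarrow> 'c::real_normed_vector) \<Rightarrow> bool" where
  "smooth_fun_on M W f \<longleftrightarrow>
     openin (mtop M) W \<and>
     (\<forall>(U, \<phi>)\<in>charts M. Cinf_on (\<phi> ` (U \<inter> W)) (f \<circ> inv_into U \<phi>))"

definition smooth_near ::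
  "('a, 'b::euclidean_space) manifold \<Rightarrow> 'a \<Rightarrow> ('a \<Rightarrow> 'c::real_normed_vector) \<Rightarrow> bool" where
  "smooth_near M p f \<longleftrightarrow> (\<exists>W. p \<in> W \<and> smooth_fun_on M W f)"


section \<open>Tangent vectors and vector fields\<close>

text \<open>A tangent vector at \<open>p\<close> is the operator sending a real function that is smooth near \<open>p\<close> to
  its derivative in some coordinate direction \<open>w\<close>. The operators are set to \<open>0\<close> on all
  other functions, so that equality of tangent vectors is equality of operators.\<close>

type_synonym 'a tvec = "('a \<Rightarrow> real) \<Rightarrow> real"
type_synonym 'a vfield = "'a \<Rightarrow> 'a tvec"

definition tangent_space :: "('a, 'b::euclidean_space) manifold \<Rightarrow> 'a \<Rightarrow> 'a tvec set" where
  "tangent_space M p =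
     {v. \<exists>(U, \<phi>)\<in>charts M. p \<in> U \<and>
        (\<exists>w. v = (\<lambda>f. if smooth_near M p f
                      then frechet_derivative (f \<circ> inv_into U \<phi>) (at (\<phi> p)) w else 0))}"

definition tlincomb :: "real \<Rightarrow> 'a tvec \<Rightarrow> real \<Rightarrow> 'a tvec \<Rightarrow> 'a tvec" where
  "tlincomb a u b v = (\<lambda>f. a * u f + b * v f)"

definition tangent_linear ::
  "('a, 'b::euclidean_space) manifold \<Rightarrow> 'a \<Rightarrow> ('a tvec \<Rightarrow> real) \<Rightarrow> bool" where
  "tangent_linear M p L \<longleftrightarrow>
     (\<forall>u\<in>tangent_space M p. \<forall>v\<in>tangent_space M p. \<forall>a b.
        L (tlincomb a u b v) = a * L u + b * L v)"

text \<open>Derivative, along a tangent vector, of a function with values in a Euclidean space.\<close>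

definition vderiv :: "'a tvec \<Rightarrow> ('a \<Rightarrow> 'e::euclidean_space) \<Rightarrow> 'e" where
  "vderiv v F = (\<Sum>i\<in>Basis. v (\<lambda>q. F q \<bullet> i) *\<^sub>R i)"

definition vector_field :: "('a, 'b::euclidean_space) manifold \<Rightarrow> 'a vfield \<Rightarrow> bool" where
  "vector_field M X \<longleftrightarrow>
     (\<forall>p\<in>points M. X p \<in> tangent_space M p) \<and>
     (\<forall>W f. smooth_fun_on M W f \<longrightarrow> smooth_fun_on M W (\<lambda>p. X p f))"

definition vf_add :: "'a vfield \<Rightarrow> 'a vfield \<Rightarrow> 'a vfield" where
  "vf_add X Y = (\<lambda>p f. X p f + Y p f)"

definition vf_diff :: "'a vfield \<Rightarrow> 'a vfield \<Rightarrow> 'a vfield" where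
  "vf_diff X Y = (\<lambda>p f. X p f - Y p f)"

definition vf_scale :: "('a \<Rightarrow> real) \<Rightarrow> 'a vfield \<Rightarrow> 'a vfield" where
  "vf_scale h X = (\<lambda>p f. h p * X p f)"

definition lie_bracket ::
  "('a, 'b::euclidean_space) manifold \<Rightarrow> 'a vfield \<Rightarrow> 'a vfield \<Rightarrow> 'a vfield" where
  "lie_bracket M X Y =
     (\<lambda>p f. if smooth_near M p f then X p (\<lambda>q. Y q f) - Y p (\<lambda>q. X q f) else 0)"

definition vf_eq ::
  "('a, 'b::euclidean_space) manifold \<Rightarrow> 'a vfield \<Rightarrow> 'a vfield \<Rightarrow> bool" where
  "vf_eq M X Y \<longleftrightarrow> (\<forall>p\<in>points M. X p = Y p)"

definition one_form ::
  "('a, 'b::euclidean_space) manifold \<Rightarrow> ('a \<Rightarrow> 'a tvec \<Rightarrow> real) \<Rightarrow> bool" where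
  "one_form M \<eta> \<longleftrightarrow>
     (\<forall>p\<in>points M. tangent_linear M p (\<eta> p)) \<and>
     (\<forall>X. vector_field M X \<longrightarrow> smooth_fun_on M (points M) (\<lambda>p. \<eta> p (X p)))"


section \<open>Riemannian metrics, the Levi-Civita connection and curvature\<close>

type_synonym 'a metric_tensor = "'a \<Rightarrow> 'a tvec \<Rightarrow> 'a tvec \<Rightarrow> real"
type_synonym 'a connection = "'a vfield \<Rightarrow> 'a vfield \<Rightarrow> 'a vfield"

definition riemannian_metric ::
  "('a, 'b::euclidean_space) manifold \<Rightarrow> 'a metric_tensor \<Rightarrow> bool" where
  "riemannian_metric M g \<longleftrightarrow>
     (\<forall>p\<in>points M.
        (\<forall>v\<in>tangent_space M p. tangent_linear M p (g p v)) \<and>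
        (\<forall>v\<in>tangent_space M p. \<forall>w\<in>tangent_space M p. g p v w = g p w v) \<and>
        (\<forall>v\<in>tangent_space M p. v \<noteq> (\<lambda>f. 0) \<longrightarrow> g p v v > 0)) \<and>
     (\<forall>X Y. vector_field M X \<longrightarrow> vector_field M Y \<longrightarrow>
        smooth_fun_on M (points M) (\<lambda>p. g p (X p) (Y p)))"

text \<open>\<open>nabla X Y\<close> is the covariant derivative of \<open>Y\<close> in the direction of \<open>X\<close>.\<close>

definition affine_connection ::
  "('a, 'b::euclidean_space) manifold \<Rightarrow> 'a connection \<Rightarrow> bool" where
  "affine_connection M nabla \<longleftrightarrow>
     (\<forall>X Y. vector_field M X \<longrightarrow> vector_field M Y \<longrightarrow> vector_field M (nabla X Y)) \<and>
     (\<forall>X Y Z. vector_field M X \<longrightarrow> vector_field M Y \<longrightarrow> vector_field M Z \<longrightarrow>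
        vf_eq M (nabla (vf_add X Y) Z) (vf_add (nabla X Z) (nabla Y Z)) \<and>
        vf_eq M (nabla X (vf_add Y Z)) (vf_add (nabla X Y) (nabla X Z))) \<and>
     (\<forall>h X Y. smooth_fun_on M (points M) h \<longrightarrow> vector_field M X \<longrightarrow> vector_field M Y \<longrightarrow>
        vf_eq M (nabla (vf_scale h X) Y) (vf_scale h (nabla X Y)) \<and>
        vf_eq M (nabla X (vf_scale h Y))
          (vf_add (vf_scale h (nabla X Y)) (vf_scale (\<lambda>p. X p h) Y)))"

definition levi_civita_connection ::
  "('a, 'b::euclidean_space) manifold \<Rightarrow> 'a metric_tensor \<Rightarrow> 'a connection \<Rightarrow> bool" where
  "levi_civita_connection M g nabla \<longleftrightarrow>
     affine_connection M nabla \<and>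
     (\<forall>X Y. vector_field M X \<longrightarrow> vector_field M Y \<longrightarrow>
        vf_eq M (vf_diff (nabla X Y) (nabla Y X)) (lie_bracket M X Y)) \<and>
     (\<forall>X Y Z. vector_field M X \<longrightarrow> vector_field M Y \<longrightarrow> vector_field M Z \<longrightarrow>
        (\<forall>p\<in>points M. X p (\<lambda>q. g q (Y q) (Z q)) =
           g p (nabla X Y p) (Z p) + g p (Y p) (nabla X Z p)))"

definition curvature ::
  "('a, 'b::euclidean_space) manifold \<Rightarrow> 'a connection \<Rightarrow>
    'a vfield \<Rightarrow> 'a vfield \<Rightarrow> 'a vfield \<Rightarrow> 'a vfield" where
  "curvature M nabla X Y Z =
     vf_diff (vf_diff (nabla X (nabla Y Z)) (nabla Y (nabla X Z)))
       (nabla (lie_bracket M X Y) Z)"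

definition jacobi_operator ::
  "('a, 'b::euclidean_space) manifold \<Rightarrow> 'a connection \<Rightarrow> 'a vfield \<Rightarrow> 'a vfield \<Rightarrow> 'a vfield"
  where "jacobi_operator M nabla X Z = curvature M nabla Z X X"

text \<open>The covariant derivative of a \<open>(1,1)\<close>-tensor field \<open>T\<close>, viewed as an operator on vector
  fields.\<close>

definition cov_deriv_tensor ::
  "'a connection \<Rightarrow> 'a vfield \<Rightarrow> ('a vfield \<Rightarrow> 'a vfield) \<Rightarrow> 'a vfield \<Rightarrow> 'a vfield" where
  "cov_deriv_tensor nabla Y T Z = vf_diff (nabla Y (T Z)) (T (nabla Y Z))"

definition recurrent_jacobi_operators ::
  "('a, 'b::euclidean_space) manifold \<Rightarrow> 'a connection \<Rightarrow> bool" where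
  "recurrent_jacobi_operators M nabla \<longleftrightarrow>
     (\<exists>\<eta>. one_form M \<eta> \<and>
        (\<forall>X Y Z. vector_field M X \<longrightarrow> vector_field M Y \<longrightarrow> vector_field M Z \<longrightarrow>
           vf_eq M (cov_deriv_tensor nabla Y (jacobi_operator M nabla X) Z)
             (vf_scale (\<lambda>p. \<eta> p (Y p)) (jacobi_operator M nabla X Z))))"


section \<open>Metric traces and the Laplacian\<close>

text \<open>Vector fields, indexed by the standard basis of the model space, whose values at the single
  point \<open>p\<close> form an orthonormal basis of the tangent space at \<open>p\<close>.\<close>

definition orthonormal_at ::
  "('a, 'b::euclidean_space) manifold \<Rightarrow> 'a metric_tensor \<Rightarrow> 'a \<Rightarrow> ('b \<Rightarrow> 'a vfield) \<Rightarrow> bool" where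
  "orthonormal_at M g p E \<longleftrightarrow>
     (\<forall>i\<in>Basis. vector_field M (E i)) \<and>
     (\<forall>i\<in>Basis. \<forall>j\<in>Basis. g p (E i p) (E j p) = (if i = j then 1 else 0))"

text \<open>Trace at \<open>p\<close>, with respect to \<open>g\<close>, of a covariant 2-tensor \<open>B\<close> given by its values
  on vector fields. \<open>B X Y\<close> depends only on \<open>X p\<close> and \<open>Y p\<close> in all uses below, so the
  choice of \<open>E\<close> is immaterial.\<close>

definition metric_trace ::
  "('a, 'b::euclidean_space) manifold \<Rightarrow> 'a metric_tensor \<Rightarrow> 'a \<Rightarrow>
    ('a vfield \<Rightarrow> 'a vfield \<Rightarrow> real) \<Rightarrow> real" where
  "metric_trace M g p B =
     (let E = (SOME E. orthonormal_at M g p E) in \<Sum>i\<in>(Basis :: 'b set). B (E i) (E i))"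

definition hessian ::
  "'a connection \<Rightarrow> ('a \<Rightarrow> real) \<Rightarrow> 'a \<Rightarrow> 'a vfield \<Rightarrow> 'a vfield \<Rightarrow> real" where
  "hessian nabla f p X Y = X p (\<lambda>q. Y q f) - nabla X Y p f"

definition laplacian ::
  "('a, 'b::euclidean_space) manifold \<Rightarrow> 'a metric_tensor \<Rightarrow> 'a connection \<Rightarrow>
    ('a \<Rightarrow> real) \<Rightarrow> 'a \<Rightarrow> real" where
  "laplacian M g nabla f p = - metric_trace M g p (hessian nabla f p)"

definition vlaplacian ::
  "('a, 'b::euclidean_space) manifold \<Rightarrow> 'a metric_tensor \<Rightarrow> 'a connection \<Rightarrow>
    ('a \<Rightarrow> 'e::euclidean_space) \<Rightarrow> 'a \<Rightarrow> 'e" where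
  "vlaplacian M g nabla F p = (\<Sum>i\<in>Basis. laplacian M g nabla (\<lambda>q. F q \<bullet> i) p *\<^sub>R i)"


section \<open>Hypersurfaces of Euclidean space\<close>

definition isometric_immersion ::
  "('a, 'b::euclidean_space) manifold \<Rightarrow> 'a metric_tensor \<Rightarrow> ('a \<Rightarrow> 'e::euclidean_space) \<Rightarrow> bool"
  where
  "isometric_immersion M g x \<longleftrightarrow>
     smooth_fun_on M (points M) x \<and>
     (\<forall>p\<in>points M. inj_on (\<lambda>v. vderiv v x) (tangent_space M p)) \<and>
     (\<forall>p\<in>points M. \<forall>v\<in>tangent_space M p. \<forall>w\<in>tangent_space M p.
        g p v w = vderiv v x \<bullet> vderiv w x)"

definition unit_normal ::
  "('a, 'b::euclidean_space) manifold \<Rightarrow> ('a \<Rightarrow> 'e::euclidean_space) \<Rightarrow> 'a set \<Rightarrow> ('a \<Rightarrow> 'e) \<Rightarrow> bool"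
  where
  "unit_normal M x U N \<longleftrightarrow>
     smooth_fun_on M U N \<and>
     (\<forall>p\<in>U. norm (N p) = 1 \<and> (\<forall>v\<in>tangent_space M p. N p \<bullet> vderiv v x = 0))"

text \<open>The Weingarten formula: the derivative of \<open>N\<close> along \<open>v\<close> is \<open>-dx (A v)\<close>.\<close>

definition shape_operator ::
  "('a, 'b::euclidean_space) manifold \<Rightarrow> ('a \<Rightarrow> 'e::euclidean_space) \<Rightarrow> ('a \<Rightarrow> 'e) \<Rightarrow>
    'a \<Rightarrow> 'a tvec \<Rightarrow> 'a tvec" where
  "shape_operator M x N p v = (THE w. w \<in> tangent_space M p \<and> vderiv v N = - vderiv w x)"

text \<open>The normalisation is \<open>nH = trace A\<close>.\<close>

definition mean_curvature ::
  "('a, 'b::euclidean_space) manifold \<Rightarrow> 'a metric_tensor \<Rightarrow> ('a \<Rightarrow> 'e::euclidean_space) \<Rightarrow>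
    ('a \<Rightarrow> 'e) \<Rightarrow> 'a \<Rightarrow> real" where
  "mean_curvature M g x N p =
     metric_trace M g p (\<lambda>X Y. g p (shape_operator M x N p (X p)) (Y p)) / real DIM('b)"

definition mean_curvature_vector ::
  "('a, 'b::euclidean_space) manifold \<Rightarrow> 'a metric_tensor \<Rightarrow> ('a \<Rightarrow> 'e::euclidean_space) \<Rightarrow>
    ('a \<Rightarrow> 'e) \<Rightarrow> 'a \<Rightarrow> 'e" where
  "mean_curvature_vector M g x N p = mean_curvature M g x N p *\<^sub>R N p"

text \<open>The mean curvature vector does not change when \<open>N\<close> is replaced by \<open>-N\<close>, and local unit
  normal fields exist near every point, so the following are conditions on all of \<open>M\<close>.\<close>

definition biharmonic_hypersurface ::
  "('a, 'b::euclidean_space) manifold \<Rightarrow> 'a metric_tensor \<Rightarrow> 'a connection \<Rightarrow>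
    ('a \<Rightarrow> 'e::euclidean_space) \<Rightarrow> bool" where
  "biharmonic_hypersurface M g nabla x \<longleftrightarrow>
     (\<forall>U N. unit_normal M x U N \<longrightarrow>
        (\<forall>p\<in>U. vlaplacian M g nabla (mean_curvature_vector M g x N) p = 0))"

definition minimal_hypersurface ::
  "('a, 'b::euclidean_space) manifold \<Rightarrow> 'a metric_tensor \<Rightarrow> ('a \<Rightarrow> 'e::euclidean_space) \<Rightarrow> bool"
  where
  "minimal_hypersurface M g x \<longleftrightarrow>
     (\<forall>U N. unit_normal M x U N \<longrightarrow> (\<forall>p\<in>U. mean_curvature M g x N p = 0))"

end

theory Submission
  imports Defs
begin

text \<open>The recurrence condition is imposed for every vector field \<open>X\<close>, but it is not tensorial in
\<open>X\<close>. Since \<open>R\<^bsub>fX\<^esub> = f\<^sup>2 R\<^sub>X\<close>, the product rule puts the term \<open>2 f (Y f) R\<^sub>X\<close> into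
\<open>\<nabla>\<^sub>Y R\<^bsub>fX\<^esub>\<close>, and comparing the conditions for \<open>X\<close> and \<open>fX\<close> at a point where \<open>f = 1\<close> and
\<open>Y f = 1\<close> leaves \<open>R\<^sub>X = 0\<close> (lemma \<open>recurrent_imp_jacobi_zero\<close>). By the Gauss equation, the shape operator
\<open>A\<close> then has rank at most one wherever its trace \<open>nH\<close> is nonzero, with eigenvalues
\<open>nH\<close> and \<open>0\<close>. The tangential part of the biharmonic equation, \<open>2 A (grad H) + n H grad H = 0\<close>, would make \<open>- n H / 2\<close> an eigenvalue
of \<open>A\<close> if \<open>H\<close> and \<open>grad H\<close> were both nonzero. Hence \<open>H grad H = 0\<close> everywhere (lemma
\<open>mean_curvature_gradient\<close>). At a point with \<open>H \<noteq> 0\<close>, differentiating this once more removes the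
Laplacian of \<open>H\<close> from the normal part of the biharmonic equation, which becomes
\<open>H trace A\<^sup>2 = 0\<close>; so \<open>A = 0\<close> there, a contradiction (lemma \<open>mean_curvature_zero\<close>).

All computations take place in the ambient Euclidean space. The connection acts on vector fields
of \<open>M\<close> as a whole, and a sufficient supply of such fields comes from the tangential parts \<open>V\<^sub>a\<close>
of constant vectors \<open>a\<close>: they are smooth because in a chart they solve a linear system whose
matrix is the Gram matrix of the coordinate vectors (lemma \<open>tangential_vector_field\<close>), and they
span every tangent space. The Koszul argument identifies the connection with the tangential
part of the flat derivative (lemma \<open>nabla_tangential\<close>). If \<open>a\<close> is tangent to \<open>M\<close> at \<open>p\<close>, all covariant
derivatives of \<open>V\<^sub>a\<close> vanish at \<open>p\<close>; for an orthonormal basis \<open>a\<^sub>1, \<dots>, a\<^sub>n\<close> of the tangent space at \<open>p\<close> these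
fields therefore behave like the coordinate fields of normal coordinates: they commute at
\<open>p\<close> and the trace of the Hessian at \<open>p\<close> is \<open>\<Sum>\<^sub>i V\<^sub>i V\<^sub>i\<close>, where \<open>V\<^sub>i\<close> is the tangential part
of \<open>a\<^sub>i\<close>. The mean curvature is the trace
\<open>n H = - \<Sum>\<^sub>u V\<^sub>u (N \<bullet> u)\<close> over any fixed orthonormal basis of the ambient space, which shows that it is
smooth and gives the trace of the Codazzi equation by a single commutation of
derivatives (lemma \<open>codazzi_trace\<close>).\<close>

section \<open>Functions of class \<open>C\<^sup>k\<close>\<close>

lemma has_derivative_cong_open:
  assumes "open S" "y \<in> S" "\<And>z. z \<in> S \<Longrightarrow> f z = g z"
  shows "(f has_derivative D) (at y) \<longleftrightarrow> (g has_derivative D) (at y)"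
  using has_derivative_transform_within_open[of f D y UNIV S g]
    has_derivative_transform_within_open[of g D y UNIV S f] assms by auto

lemma frechet_derivative_cong_open:
  assumes "open S" "y \<in> S" "\<And>z. z \<in> S \<Longrightarrow> f z = g z"
  shows "frechet_derivative f (at y) = frechet_derivative g (at y)"
  using has_derivative_cong_open[OF assms] by (simp add: frechet_derivative_def)

lemma Ck_on_cong:
  assumes "open S" "Ck_on k S f" "\<And>z. z \<in> S \<Longrightarrow> f z = g z"
  shows "Ck_on k S g"
  using assms
proof (induction k arbitrary: f g)
  case 0
  then show ?case using continuous_on_cong[of S S f g] by simp
next
  case (Suc k)
  have "g differentiable (at y)" if "y \<in> S" for y
    using has_derivative_cong_open[where f = f and g = g, OF Suc.prems(1) that Suc.prems(3)]
      Suc.prems(2) that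
    unfolding differentiable_def Ck_on.simps by blast
  moreover have "Ck_on k S (\<lambda>y. frechet_derivative g (at y) v)" for v
    using Suc.IH[of "\<lambda>y. frechet_derivative f (at y) v"] Suc.prems
      frechet_derivative_cong_open[where f = f and g = g, OF Suc.prems(1) _ Suc.prems(3)] by simp
  ultimately show ?case by simp
qed

lemma Ck_on_subset: "Ck_on k S f \<Longrightarrow> S' \<subseteq> S \<Longrightarrow> Ck_on k S' f"
  by (induction k arbitrary: f) (auto intro: continuous_on_subset)

lemma Ck_on_Suc_imp: "Ck_on (Suc k) S f \<Longrightarrow> Ck_on k S f"
proof (induction k arbitrary: f)
  case 0
  then show ?case
    by (auto intro!: continuous_at_imp_continuous_on differentiable_imp_continuous_within)
qed auto

text \<open>Every closure property below is proved by induction on \<open>k\<close>. In the step it is enough to exhibit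
some formula for the derivative that is of class \<open>C\<^sup>k\<close> by the induction hypothesis.\<close>

lemma Ck_on_SucI:
  assumes "open S" "\<And>y. y \<in> S \<Longrightarrow> (f has_derivative D y) (at y)"
    and "\<And>v. Ck_on k S (\<lambda>y. D y v)"
  shows "Ck_on (Suc k) S f"
proof -
  have "frechet_derivative f (at y) = D y" if "y \<in> S" for y
    using frechet_derivative_at[OF assms(2)[OF that]] by simp
  then show ?thesis
    using assms Ck_on_cong[OF assms(1) assms(3)] by (auto simp: differentiable_def)
qed

lemma Ck_on_SucD:
  assumes "Ck_on (Suc k) S f" "y \<in> S"
  shows "(f has_derivative frechet_derivative f (at y)) (at y)"
  using assms by (simp add: frechet_derivative_works)

lemma Ck_on_const: "Ck_on k S (\<lambda>y. c)"
proof (induction k arbitrary: c)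
  case (Suc k) then show ?case by (simp add: frechet_derivative_const)
qed simp

lemma Ck_on_add:
  "open S \<Longrightarrow> Ck_on k S f \<Longrightarrow> Ck_on k S g \<Longrightarrow> Ck_on k S (\<lambda>y. f y + g y)"
proof (induction k arbitrary: f g)
  case 0
  then show ?case by (auto intro: continuous_on_add)
next
  case (Suc k)
  show ?case
    by (rule Ck_on_SucI[OF Suc.prems(1) has_derivative_add[OF Ck_on_SucD Ck_on_SucD]])
      (use Suc in auto)
qed

lemma Ck_on_linear:
  assumes "bounded_linear L" "open S"
  shows "Ck_on k S f \<Longrightarrow> Ck_on k S (\<lambda>y. L (f y))"
proof (induction k arbitrary: f)
  case 0
  then show ?case by (auto intro: bounded_linear.continuous_on[OF assms(1)])
next
  case (Suc k)
  show ?case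
    by (rule Ck_on_SucI[OF assms(2) bounded_linear.has_derivative[OF assms(1) Ck_on_SucD]])
      (use Suc in auto)
qed

lemma Ck_on_bilinear:
  assumes "bounded_bilinear pr" "open S"
  shows "Ck_on k S f \<Longrightarrow> Ck_on k S g \<Longrightarrow> Ck_on k S (\<lambda>y. pr (f y) (g y))"
proof (induction k arbitrary: f g)
  case 0
  then show ?case by (auto intro: bounded_bilinear.continuous_on[OF assms(1)])
next
  case (Suc k)
  show ?case
  proof (rule Ck_on_SucI[OF assms(2) bounded_bilinear.FDERIV[OF assms(1) Ck_on_SucD Ck_on_SucD]])
    show "Ck_on k S (\<lambda>y. pr (f y) (frechet_derivative g (at y) v) +
        pr (frechet_derivative f (at y) v) (g y))" for v
      using Suc.prems by (intro Ck_on_add[OF assms(2)] Suc.IH Ck_on_Suc_imp[OF Suc.prems(1)]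
        Ck_on_Suc_imp[OF Suc.prems(2)]) auto
  qed (use Suc in auto)
qed

lemma Ck_on_sum:
  "open S \<Longrightarrow> finite I \<Longrightarrow> (\<And>i. i \<in> I \<Longrightarrow> Ck_on k S (f i)) \<Longrightarrow> Ck_on k S (\<lambda>y. \<Sum>i\<in>I. f i y)"
proof (induction I rule: infinite_finite_induct)
  case (insert i I)
  then have "Ck_on k S (\<lambda>y. f i y + (\<Sum>i\<in>I. f i y))"
    by (intro Ck_on_add) auto
  with insert show ?case by simp
qed (auto simp: Ck_on_const)

section \<open>Linear systems with smooth coefficients\<close>

text \<open>The product rule has no term with the derivative of \<open>f\<close> because that term would be multiplied by
\<open>h y = 0\<close>; accordingly \<open>f\<close> has to be continuous only.\<close>

lemma has_derivative_mult_vanishing: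
  fixes f :: "'b::real_normed_vector \<Rightarrow> real" and h :: "'b \<Rightarrow> 'c::real_normed_vector"
  assumes f: "isCont f y" and h: "(h has_derivative D) (at y)" and 0: "h y = 0"
  shows "((\<lambda>z. f z *\<^sub>R h z) has_derivative (\<lambda>v. f y *\<^sub>R D v)) (at y)"
proof -
  have D: "bounded_linear D" using h by (rule has_derivative_bounded_linear)
  obtain B where B: "\<And>v. norm (D v) \<le> norm v * B" using bounded_linear.bounded[OF D] by blast
  have lim: "((\<lambda>z. norm (h z - h y - D (z - y)) / norm (z - y)) \<longlongrightarrow> 0) (at y)"
    using h by (simp add: has_derivative_iff_norm)
  have f0: "((\<lambda>z. \<bar>f z - f y\<bar>) \<longlongrightarrow> 0) (at y)"
    using f by (metis LIM_zero isCont_def tendsto_rabs_zero)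
  have fl: "((\<lambda>z. \<bar>f z\<bar>) \<longlongrightarrow> \<bar>f y\<bar>) (at y)"
    using f by (metis isCont_def tendsto_rabs)
  have "((\<lambda>z. \<bar>f z\<bar> * (norm (h z - h y - D (z - y)) / norm (z - y)) + \<bar>f z - f y\<bar> * B) \<longlongrightarrow>
      \<bar>f y\<bar> * 0 + 0 * B) (at y)"
    by (intro tendsto_add tendsto_mult fl lim f0 tendsto_const)
  then have lim2: "((\<lambda>z. \<bar>f z\<bar> * (norm (h z - h y - D (z - y)) / norm (z - y)) + \<bar>f z - f y\<bar> * B)
      \<longlongrightarrow> 0) (at y)" by simp
  have bd: "norm (f z *\<^sub>R h z - f y *\<^sub>R h y - f y *\<^sub>R D (z - y)) / norm (z - y) \<le>
      \<bar>f z\<bar> * (norm (h z - h y - D (z - y)) / norm (z - y)) + \<bar>f z - f y\<bar> * B"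
    if "z \<noteq> y" for z
  proof -
    have "f z *\<^sub>R h z - f y *\<^sub>R h y - f y *\<^sub>R D (z - y) =
        f z *\<^sub>R (h z - h y - D (z - y)) + (f z - f y) *\<^sub>R D (z - y)"
      by (simp add: 0 algebra_simps)
    then have "norm (f z *\<^sub>R h z - f y *\<^sub>R h y - f y *\<^sub>R D (z - y)) \<le>
        \<bar>f z\<bar> * norm (h z - h y - D (z - y)) + \<bar>f z - f y\<bar> * (norm (z - y) * B)"
      by (smt (verit) B abs_ge_zero mult_left_mono norm_scaleR norm_triangle_ineq)
    with that show ?thesis by (simp add: field_simps)
  qed
  show ?thesis
    unfolding has_derivative_iff_norm
  proof
    show "bounded_linear (\<lambda>v. f y *\<^sub>R D v)" by (rule bounded_linear_const_scaleR[OF D])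
    show "((\<lambda>z. norm (f z *\<^sub>R h z - f y *\<^sub>R h y - f y *\<^sub>R D (z - y)) / norm (z - y)) \<longlongrightarrow> 0) (at y)"
    proof (rule tendsto_sandwich[OF _ _ tendsto_const lim2])
      show "\<forall>\<^sub>F z in at y. norm (f z *\<^sub>R h z - f y *\<^sub>R h y - f y *\<^sub>R D (z - y)) / norm (z - y) \<le>
          \<bar>f z\<bar> * (norm (h z - h y - D (z - y)) / norm (z - y)) + \<bar>f z - f y\<bar> * B"
        unfolding eventually_at_filter using bd by (blast intro: always_eventually)
    qed simp
  qed
qed

lemma linear_sum_Basis:
  fixes L :: "'b::euclidean_space \<Rightarrow> 'c::real_vector"
  assumes "linear L" shows "L w = (\<Sum>i\<in>Basis. (w \<bullet> i) *\<^sub>R L i)"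
proof -
  have "L w = L (\<Sum>i\<in>Basis. (w \<bullet> i) *\<^sub>R i)" by (simp add: euclidean_representation)
  also have "\<dots> = (\<Sum>i\<in>Basis. (w \<bullet> i) *\<^sub>R L i)"
    using assms by (simp add: linear_sum linear_cmul)
  finally show ?thesis .
qed

text \<open>Subtracting the two systems and moving the change of the coefficients to the right-hand side
expresses the change of the solution through the inverse of \<open>G\<close> at the single point \<open>y\<close>.\<close>

lemma linear_system_solution_difference:
  fixes G :: "'y \<Rightarrow> 'b::euclidean_space \<Rightarrow> 'c::real_vector"
  assumes "linear (G y)" "linear (G z)" "linear K" "K \<circ> G y = id"
    and "G y (w y) = b y" "G z (w z) = b z"
  shows "w z - w y = K (b z - b y - (\<Sum>i\<in>Basis. (w z \<bullet> i) *\<^sub>R (G z i - G y i)))"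
proof -
  have "(\<Sum>i\<in>Basis. (w z \<bullet> i) *\<^sub>R (G z i - G y i)) = G z (w z) - G y (w z)"
    using linear_sum_Basis[OF assms(1), of "w z"] linear_sum_Basis[OF assms(2), of "w z"]
    by (simp add: scaleR_right_diff_distrib sum_subtractf)
  then have "K (b z - b y - (\<Sum>i\<in>Basis. (w z \<bullet> i) *\<^sub>R (G z i - G y i))) = K (G y (w z) - G y (w y))"
    using assms by simp
  also have "\<dots> = K (G y (w z - w y))" using assms(1) by (simp add: linear_diff)
  finally show ?thesis using assms(4) by (metis comp_apply id_apply)
qed

text \<open>Applying the inverse \<open>K\<close> of \<open>G y\<close> to the difference of the two systems bounds \<open>w z - w y\<close> by
a small multiple of itself plus terms that tend to \<open>0\<close>; once the factor is at most \<open>1/2\<close>, the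
multiple is absorbed on the left.\<close>

lemma linear_system_continuous:
  fixes G :: "'b::euclidean_space \<Rightarrow> 'b \<Rightarrow> 'b"
  assumes S: "open S" "y \<in> S"
    and lin: "\<And>z. z \<in> S \<Longrightarrow> linear (G z)" and inj: "inj (G y)"
    and sol: "\<And>z. z \<in> S \<Longrightarrow> G z (w z) = b z"
    and G: "\<And>i. isCont (\<lambda>z. G z i) y" and b: "isCont b y"
  shows "isCont w y"
proof -
  obtain K where K: "linear K" "K \<circ> G y = id"
    using linear_injective_left_inverse[OF lin[OF S(2)] inj] by blast
  obtain C where C: "C > 0" "\<And>v. norm (K v) \<le> C * norm v"
    using linear_bounded_pos[OF K(1)] by blast
  define r where "r z = (\<Sum>i\<in>Basis. norm (G z i - G y i))" for z
  have r0: "(r \<longlongrightarrow> 0) (at y)"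
  proof -
    have "((\<lambda>z. norm (G z i - G y i)) \<longlongrightarrow> 0) (at y)" for i
      using G[of i] by (simp add: isCont_def LIM_zero tendsto_norm_zero)
    then have "((\<lambda>z. \<Sum>i\<in>Basis. norm (G z i - G y i)) \<longlongrightarrow> (\<Sum>i\<in>(Basis::'b set). 0)) (at y)"
      by (intro tendsto_sum)
    then show ?thesis by (simp add: r_def[abs_def])
  qed
  have b0: "((\<lambda>z. norm (b z - b y)) \<longlongrightarrow> 0) (at y)"
    using b by (simp add: isCont_def LIM_zero tendsto_norm_zero)
  have bound: "norm (w z - w y) \<le> 2 * C * (norm (b z - b y) + r z * norm (w y))"
    if z: "z \<in> S" "C * r z < 1/2" for z
  proof -
    have rz: "0 \<le> r z" by (simp add: r_def sum_nonneg)
    have "norm (\<Sum>i\<in>Basis. (w z \<bullet> i) *\<^sub>R (G z i - G y i)) \<le> (\<Sum>i\<in>Basis. norm (w z) * norm (G z i - G y i))"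
      by (rule sum_norm_le) (simp add: Basis_le_norm mult_right_mono)
    then have s: "norm (\<Sum>i\<in>Basis. (w z \<bullet> i) *\<^sub>R (G z i - G y i)) \<le> norm (w z) * r z"
      by (simp add: r_def sum_distrib_left)
    have "norm (w z - w y) \<le> C * norm (b z - b y - (\<Sum>i\<in>Basis. (w z \<bullet> i) *\<^sub>R (G z i - G y i)))"
      using linear_system_solution_difference[where w = w, OF lin[OF S(2)] lin[OF z(1)] K sol[OF S(2)] sol[OF z(1)]]
        C(2) by metis
    also have "\<dots> \<le> C * (norm (b z - b y) + norm (w z) * r z)"
      using C(1) s norm_triangle_ineq4[of "b z - b y" "\<Sum>i\<in>Basis. (w z \<bullet> i) *\<^sub>R (G z i - G y i)"]
      by (intro mult_left_mono) auto
    also have "\<dots> \<le> C * (norm (b z - b y) + (norm (w y) + norm (w z - w y)) * r z)"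
      using C(1) rz norm_triangle_sub[of "w z" "w y"]
      by (intro mult_left_mono add_left_mono mult_right_mono) auto
    also have "\<dots> = C * (norm (b z - b y) + r z * norm (w y)) + (C * r z) * norm (w z - w y)"
      by (simp add: algebra_simps)
    also have "\<dots> \<le> C * (norm (b z - b y) + r z * norm (w y)) + (1/2) * norm (w z - w y)"
      using z(2) by (intro add_left_mono mult_right_mono) auto
    \<comment> \<open>Half of \<open>norm (w z - w y)\<close> is absorbed, which doubles the constant.\<close>
    finally show ?thesis by simp
  qed
  have "((\<lambda>z. C * r z) \<longlongrightarrow> C * 0) (at y)" by (intro tendsto_mult tendsto_const r0)
  then have "eventually (\<lambda>z. C * r z < 1/2) (at y)"
    by (rule order_tendstoD(2)) simp
  moreover have "eventually (\<lambda>z. z \<in> S) (at y)"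
    using S by (simp add: eventually_at_topological) blast
  ultimately have ev: "eventually (\<lambda>z. norm (w z - w y) \<le>
      2 * C * (norm (b z - b y) + r z * norm (w y))) (at y)"
    by eventually_elim (rule bound)
  have "((\<lambda>z. 2 * C * (norm (b z - b y) + r z * norm (w y))) \<longlongrightarrow> 2 * C * (0 + 0 * norm (w y))) (at y)"
    by (intro tendsto_mult tendsto_add tendsto_const r0 b0)
  then have "((\<lambda>z. w z - w y) \<longlongrightarrow> 0) (at y)"
    by (intro Lim_null_comparison[OF ev]) simp
  then show ?thesis by (simp add: isCont_def LIM_zero_iff)
qed

text \<open>In the identity for \<open>w z - w y\<close> the unknown \<open>w z\<close> multiplies only functions that vanish at \<open>y\<close>, so
that continuity of \<open>w\<close> suffices for differentiability.\<close>

lemma linear_system_has_derivative: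
  fixes G :: "'b::euclidean_space \<Rightarrow> 'b \<Rightarrow> 'b"
  assumes S: "open S" "y \<in> S"
    and lin: "\<And>z. z \<in> S \<Longrightarrow> linear (G z)" and inj: "inj (G y)"
    and sol: "\<And>z. z \<in> S \<Longrightarrow> G z (w z) = b z"
    and G: "\<And>i. ((\<lambda>z. G z i) has_derivative G' i) (at y)" and b: "(b has_derivative b') (at y)"
  shows "\<exists>w'. (w has_derivative w') (at y) \<and>
    (\<forall>v. G y (w' v) = b' v - (\<Sum>i\<in>Basis. (w y \<bullet> i) *\<^sub>R G' i v))"
proof -
  obtain K where K: "linear K" "K \<circ> G y = id"
    using linear_injective_left_inverse[OF lin[OF S(2)] inj] by blast
  have KG: "G y (K v) = v" for v
  proof -
    obtain u where "v = G y u"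
      using linear_injective_imp_surjective[OF lin[OF S(2)] inj] by (metis surjD)
    then show ?thesis using K(2) by (metis comp_apply id_apply)
  qed
  have w: "isCont w y"
    using linear_system_continuous[OF S lin inj sol has_derivative_continuous[OF G]
        has_derivative_continuous[OF b]] .
  have D: "((\<lambda>z. w y + K (b z - b y - (\<Sum>i\<in>Basis. (w z \<bullet> i) *\<^sub>R (G z i - G y i)))) has_derivative
      (\<lambda>v. K (b' v - (\<Sum>i\<in>Basis. (w y \<bullet> i) *\<^sub>R G' i v)))) (at y)"
  proof -
    have "((\<lambda>z. (w z \<bullet> i) *\<^sub>R (G z i - G y i)) has_derivative (\<lambda>v. (w y \<bullet> i) *\<^sub>R G' i v)) (at y)" for i
      using has_derivative_diff[OF G[of i] has_derivative_const[of "G y i"]] w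
      by (intro has_derivative_mult_vanishing) (auto intro: isCont_inner)
    then have "((\<lambda>z. b z - b y - (\<Sum>i\<in>Basis. (w z \<bullet> i) *\<^sub>R (G z i - G y i))) has_derivative
        (\<lambda>v. b' v - 0 - (\<Sum>i\<in>Basis. (w y \<bullet> i) *\<^sub>R G' i v))) (at y)"
      by (intro has_derivative_diff has_derivative_sum b has_derivative_const)
    from has_derivative_add[OF has_derivative_const
        bounded_linear.has_derivative[OF linear_conv_bounded_linear[THEN iffD1, OF K(1)] this]]
    show ?thesis by simp
  qed
  have "(w has_derivative (\<lambda>v. K (b' v - (\<Sum>i\<in>Basis. (w y \<bullet> i) *\<^sub>R G' i v)))) (at y)"
  proof (rule has_derivative_transform_within_open[OF D S])
    fix z assume "z \<in> S"
    from linear_system_solution_difference[where w = w, OF lin[OF S(2)] lin[OF this] K sol[OF S(2)] sol[OF this]]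
    show "w y + K (b z - b y - (\<Sum>i\<in>Basis. (w z \<bullet> i) *\<^sub>R (G z i - G y i))) = w z"
      by (simp add: algebra_simps)
  qed
  with KG show ?thesis by blast
qed

text \<open>This is the smoothness of the inverse matrix without mentioning the inverse: the derivative of a
solution solves a system with the same matrix, whose right-hand side contains the solution
itself but no derivative of it. The induction therefore has to run over all right-hand sides at once.\<close>

lemma Ck_on_linear_system:
  fixes G :: "'b::euclidean_space \<Rightarrow> 'b \<Rightarrow> 'b"
  assumes S: "open S"
    and lin: "\<And>z. z \<in> S \<Longrightarrow> linear (G z)" and inj: "\<And>z. z \<in> S \<Longrightarrow> inj (G z)"
    and G: "\<And>i. Cinf_on S (\<lambda>z. G z i)"
  shows "(\<And>z. z \<in> S \<Longrightarrow> G z (w z) = b z) \<Longrightarrow> Ck_on k S b \<Longrightarrow> Ck_on k S w"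
proof (induction k arbitrary: w b)
  case 0
  have Gc: "isCont (\<lambda>z. G z i) y" if "y \<in> S" for i y
    using G[of i, unfolded Cinf_on_def, rule_format, of 0] that S
    by (simp add: continuous_on_eq_continuous_at)
  show ?case
    using 0 S linear_system_continuous[OF S _ lin inj _ Gc, of _ w b]
    by (simp add: continuous_on_eq_continuous_at)
next
  case (Suc k)
  have GS: "Ck_on (Suc j) S (\<lambda>z. G z i)" for i j
    using G[of i] unfolding Cinf_on_def by blast
  have "\<forall>y\<in>S. \<exists>w'. (w has_derivative w') (at y) \<and>
    (\<forall>v. G y (w' v) = frechet_derivative b (at y) v -
      (\<Sum>i\<in>Basis. (w y \<bullet> i) *\<^sub>R frechet_derivative (\<lambda>z. G z i) (at y) v))"
  proof
    fix y assume y: "y \<in> S"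
    show "\<exists>w'. (w has_derivative w') (at y) \<and>
      (\<forall>v. G y (w' v) = frechet_derivative b (at y) v -
        (\<Sum>i\<in>Basis. (w y \<bullet> i) *\<^sub>R frechet_derivative (\<lambda>z. G z i) (at y) v))"
      by (rule linear_system_has_derivative[OF S y lin inj[OF y] Suc.prems(1)
          Ck_on_SucD[OF GS y] Ck_on_SucD[OF Suc.prems(2) y]])
  qed
  from bchoice[OF this] obtain w' where w': "\<And>y. y \<in> S \<Longrightarrow> (w has_derivative w' y) (at y)"
    "\<And>y v. y \<in> S \<Longrightarrow> G y (w' y v) = frechet_derivative b (at y) v -
      (\<Sum>i\<in>Basis. (w y \<bullet> i) *\<^sub>R frechet_derivative (\<lambda>z. G z i) (at y) v)"
    by blast
  have wk: "Ck_on k S w" using Suc.IH[of w b] Suc.prems Ck_on_Suc_imp by blast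
  show ?case
  proof (rule Ck_on_SucI[OF S w'(1)])
    fix v
    have "Ck_on k S (\<lambda>y. (w y \<bullet> i) *\<^sub>R frechet_derivative (\<lambda>z. G z i) (at y) v)" for i
      using GS[of k i] wk
      by (intro Ck_on_bilinear[OF bounded_bilinear_scaleR S] Ck_on_linear[OF bounded_linear_inner_left S]) auto
    then have "Ck_on k S (\<lambda>y. frechet_derivative b (at y) v + -
      (\<Sum>i\<in>Basis. (w y \<bullet> i) *\<^sub>R frechet_derivative (\<lambda>z. G z i) (at y) v))"
      using Suc.prems(2)
      by (intro Ck_on_add[OF S] Ck_on_linear[OF bounded_linear_minus[OF bounded_linear_ident] S] Ck_on_sum[OF S]) auto
    with w'(2) show "Ck_on k S (\<lambda>y. w' y v)"
      by (intro Suc.IH[of "\<lambda>y. w' y v"]) auto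
  qed
qed

section \<open>Smooth functions and tangent vectors\<close>

definition chart_vec ::
  "('a, 'b::euclidean_space) manifold \<Rightarrow> 'a set \<Rightarrow> ('a \<Rightarrow> 'b) \<Rightarrow> 'a \<Rightarrow> 'b \<Rightarrow> 'a tvec" where
  "chart_vec M U \<phi> p w = (\<lambda>f. if smooth_near M p f
     then frechet_derivative (f \<circ> inv_into U \<phi>) (at (\<phi> p)) w else 0)"

lemma smooth_fun_on_openin: "smooth_fun_on M W f \<Longrightarrow> openin (mtop M) W"
  by (simp add: smooth_fun_on_def)

lemma smooth_fun_onD:
  "smooth_fun_on M W f \<Longrightarrow> (U, \<phi>) \<in> charts M \<Longrightarrow> Ck_on k (\<phi> ` (U \<inter> W)) (f \<circ> inv_into U \<phi>)"
  by (auto simp: smooth_fun_on_def Cinf_on_def)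

lemma smooth_fun_onI:
  assumes "openin (mtop M) W"
    and "\<And>U \<phi> k. (U, \<phi>) \<in> charts M \<Longrightarrow> Ck_on k (\<phi> ` (U \<inter> W)) (f \<circ> inv_into U \<phi>)"
  shows "smooth_fun_on M W f"
  using assms by (auto simp: smooth_fun_on_def Cinf_on_def)

lemma openin_points: "openin (mtop M) W \<Longrightarrow> p \<in> W \<Longrightarrow> p \<in> points M"
  using openin_subset by (fastforce simp: points_def)

lemma openin_points_self: "openin (mtop M) (points M)"
  by (simp add: points_def)

lemma smooth_nearI: "smooth_fun_on M W f \<Longrightarrow> p \<in> W \<Longrightarrow> smooth_near M p f"
  by (auto simp: smooth_near_def)

lemma smooth_near_points: "smooth_near M p f \<Longrightarrow> p \<in> points M"
  using smooth_fun_on_openin openin_points by (fastforce simp: smooth_near_def)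

lemma smooth_fun_on_subset:
  assumes "smooth_fun_on M W f" "openin (mtop M) W'" "W' \<subseteq> W"
  shows "smooth_fun_on M W' f"
proof (rule smooth_fun_onI[OF assms(2)])
  fix U \<phi> k assume "(U, \<phi>) \<in> charts M"
  from smooth_fun_onD[OF assms(1) this] show "Ck_on k (\<phi> ` (U \<inter> W')) (f \<circ> inv_into U \<phi>)"
    by (rule Ck_on_subset) (use assms(3) in auto)
qed

abbreviation der :: "'a vfield \<Rightarrow> ('a \<Rightarrow> 'e::euclidean_space) \<Rightarrow> 'a \<Rightarrow> 'e" where
  "der X F \<equiv> \<lambda>q. vderiv (X q) F"

lemma vderiv_inner_Basis: "i \<in> Basis \<Longrightarrow> vderiv v F \<bullet> i = v (\<lambda>q. F q \<bullet> i)"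
  by (simp add: vderiv_def)

lemma vderiv_vf_diff: "vderiv (vf_diff X Y p) F = vderiv (X p) F - vderiv (Y p) F"
  by (simp add: vderiv_def vf_diff_def sum_subtractf algebra_simps)

lemma vderiv_vf_scale: "vderiv (vf_scale h X p) F = h p *\<^sub>R vderiv (X p) F"
  by (simp add: vderiv_def vf_scale_def scaleR_sum_right)

lemma vf_diff_tlincomb: "vf_diff X Y p = tlincomb 1 (X p) (- 1) (Y p)"
  by (simp add: vf_diff_def tlincomb_def)

lemma vderiv_real: "vderiv v (f :: 'a \<Rightarrow> real) = v f"
  by (simp add: vderiv_def)

lemma vderiv_tlincomb: "vderiv (tlincomb a u b v) F = a *\<^sub>R vderiv u F + b *\<^sub>R vderiv v F"
  by (simp add: vderiv_def tlincomb_def scaleR_sum_right sum.distrib algebra_simps)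

lemma vderiv_zero: "vderiv (\<lambda>f. 0) F = 0"
  by (simp add: vderiv_def)

locale smooth_mfd =
  fixes M :: "('a, 'b::euclidean_space) manifold"
  assumes smooth_manifold: "smooth_manifold M"
begin

lemma chart_openin: "(U, \<phi>) \<in> charts M \<Longrightarrow> openin (mtop M) U"
  using smooth_manifold unfolding smooth_manifold_def by fast

lemma chart_subset: "(U, \<phi>) \<in> charts M \<Longrightarrow> U \<subseteq> points M"
  using chart_openin openin_subset by (fastforce simp: points_def)

lemma chart_homeomorphic:
  "(U, \<phi>) \<in> charts M \<Longrightarrow>
    homeomorphic_map (subtopology (mtop M) U) (top_of_set (\<phi> ` U)) \<phi> \<and> open (\<phi> ` U)"
  using smooth_manifold unfolding smooth_manifold_def by fast

lemma chart_inj: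
  assumes "(U, \<phi>) \<in> charts M" shows "inj_on \<phi> U"
proof -
  have "topspace (subtopology (mtop M) U) = U"
    using chart_openin[OF assms] openin_subset by fastforce
  then show ?thesis
    using homeomorphic_imp_injective_map[OF conjunct1[OF chart_homeomorphic[OF assms]]] by simp
qed

lemma chart_open:
  assumes c: "(U, \<phi>) \<in> charts M" and W: "openin (mtop M) W"
  shows "open (\<phi> ` (U \<inter> W))"
proof -
  have "openin (subtopology (mtop M) U) (U \<inter> W)"
    using W by (metis inf_commute openin_subtopology_Int)
  then have "openin (top_of_set (\<phi> ` U)) (\<phi> ` (U \<inter> W))"
    using homeomorphic_imp_open_map[OF conjunct1[OF chart_homeomorphic[OF c]]]
    by (simp add: open_map_def)
  then show ?thesis
    using chart_homeomorphic[OF c] openin_open_trans by blast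
qed

lemma chart_cover:
  assumes "p \<in> points M" obtains U \<phi> where "(U, \<phi>) \<in> charts M" "p \<in> U"
proof -
  have "points M = (\<Union>(U, \<phi>)\<in>charts M. U)"
    using smooth_manifold by (simp add: smooth_manifold_def)
  then show ?thesis using assms that by auto
qed

lemma chart_transition:
  "(U, \<phi>) \<in> charts M \<Longrightarrow> (V, \<psi>) \<in> charts M \<Longrightarrow> Ck_on k (\<phi> ` (U \<inter> V)) (\<psi> \<circ> inv_into U \<phi>)"
  using smooth_manifold unfolding smooth_manifold_def Cinf_on_def by fast

lemma inv_chart: "(U, \<phi>) \<in> charts M \<Longrightarrow> p \<in> U \<Longrightarrow> inv_into U \<phi> (\<phi> p) = p"
  using chart_inj by (simp add: inv_into_f_f)

lemma smooth_fun_on_cong: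
  assumes "smooth_fun_on M W f" "\<And>q. q \<in> W \<Longrightarrow> f q = h q"
  shows "smooth_fun_on M W h"
proof (rule smooth_fun_onI[OF smooth_fun_on_openin[OF assms(1)]])
  fix U \<phi> k assume c: "(U, \<phi>) \<in> charts M"
  show "Ck_on k (\<phi> ` (U \<inter> W)) (h \<circ> inv_into U \<phi>)"
    by (rule Ck_on_cong[OF chart_open[OF c smooth_fun_on_openin[OF assms(1)]]
          smooth_fun_onD[OF assms(1) c]]) (auto simp: inv_chart[OF c] assms(2))
qed

lemma smooth_near_cong:
  assumes "openin (mtop M) W" "p \<in> W" "\<And>q. q \<in> W \<Longrightarrow> f q = h q"
  shows "smooth_near M p f \<longleftrightarrow> smooth_near M p h"
proof -
  have *: "smooth_near M p h" if f: "smooth_near M p f" and eq: "\<And>q. q \<in> W \<Longrightarrow> f q = h q"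
    for f h :: "'a \<Rightarrow> 'x::real_normed_vector"
  proof -
    obtain V where V: "p \<in> V" "smooth_fun_on M V f" using f by (auto simp: smooth_near_def)
    have "smooth_fun_on M (V \<inter> W) f"
      using V smooth_fun_on_openin[OF V(2)] assms(1) by (intro smooth_fun_on_subset[OF V(2)]) auto
    then have "smooth_fun_on M (V \<inter> W) h"
      by (rule smooth_fun_on_cong) (use eq in auto)
    then show ?thesis by (rule smooth_nearI) (use V assms in auto)
  qed
  show ?thesis using *[of f h] *[of h f] assms(3) by auto
qed

lemma smooth_fun_on_const: "openin (mtop M) W \<Longrightarrow> smooth_fun_on M W (\<lambda>q. c)"
  by (rule smooth_fun_onI) (simp_all add: o_def Ck_on_const)

lemma smooth_fun_on_add:
  assumes "smooth_fun_on M W f" "smooth_fun_on M W h"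
  shows "smooth_fun_on M W (\<lambda>q. f q + h q)"
proof (rule smooth_fun_onI[OF smooth_fun_on_openin[OF assms(1)]])
  fix U \<phi> k assume c: "(U, \<phi>) \<in> charts M"
  show "Ck_on k (\<phi> ` (U \<inter> W)) ((\<lambda>q. f q + h q) \<circ> inv_into U \<phi>)"
    using Ck_on_add[OF chart_open[OF c smooth_fun_on_openin[OF assms(1)]] smooth_fun_onD[OF assms(1) c] smooth_fun_onD[OF assms(2) c]] by (simp add: o_def)
qed

lemma smooth_fun_on_linear:
  assumes "bounded_linear L" "smooth_fun_on M W f"
  shows "smooth_fun_on M W (\<lambda>q. L (f q))"
proof (rule smooth_fun_onI[OF smooth_fun_on_openin[OF assms(2)]])
  fix U \<phi> k assume c: "(U, \<phi>) \<in> charts M"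
  show "Ck_on k (\<phi> ` (U \<inter> W)) ((\<lambda>q. L (f q)) \<circ> inv_into U \<phi>)"
    using Ck_on_linear[OF assms(1) chart_open[OF c smooth_fun_on_openin[OF assms(2)]] smooth_fun_onD[OF assms(2) c]] by (simp add: o_def)
qed

lemma smooth_fun_on_bilinear:
  assumes "bounded_bilinear pr" "smooth_fun_on M W f" "smooth_fun_on M W h"
  shows "smooth_fun_on M W (\<lambda>q. pr (f q) (h q))"
proof (rule smooth_fun_onI[OF smooth_fun_on_openin[OF assms(2)]])
  fix U \<phi> k assume c: "(U, \<phi>) \<in> charts M"
  show "Ck_on k (\<phi> ` (U \<inter> W)) ((\<lambda>q. pr (f q) (h q)) \<circ> inv_into U \<phi>)"
    using Ck_on_bilinear[OF assms(1) chart_open[OF c smooth_fun_on_openin[OF assms(2)]] smooth_fun_onD[OF assms(2) c] smooth_fun_onD[OF assms(3) c]] by (simp add: o_def)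
qed

lemma smooth_fun_on_sum:
  assumes "openin (mtop M) W" "\<And>i. i \<in> I \<Longrightarrow> smooth_fun_on M W (f i)"
  shows "smooth_fun_on M W (\<lambda>q. \<Sum>i\<in>I. f i q)"
  using assms(2)
proof (induction I rule: infinite_finite_induct)
  case (insert i I)
  then show ?case by (simp add: smooth_fun_on_add)
qed (simp_all add: smooth_fun_on_const assms(1))

lemmas smooth_fun_on_inner_const = smooth_fun_on_linear[OF bounded_linear_inner_left]

lemma smooth_fun_on_diff:
  assumes "smooth_fun_on M W f" "smooth_fun_on M W h"
  shows "smooth_fun_on M W (\<lambda>q. f q - h q)"
  using smooth_fun_on_add[OF assms(1)
      smooth_fun_on_linear[OF bounded_linear_minus[OF bounded_linear_ident] assms(2)]] by simp

lemma smooth_near_linear: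
  assumes "bounded_linear L" "smooth_near M p f"
  shows "smooth_near M p (\<lambda>q. L (f q))"
proof -
  obtain W where "p \<in> W" "smooth_fun_on M W f" using assms(2) by (auto simp: smooth_near_def)
  then show ?thesis using smooth_nearI[OF smooth_fun_on_linear[OF assms(1)]] by blast
qed

lemma smooth_near_common:
  assumes "smooth_near M p f" "smooth_near M p h"
  obtains W where "p \<in> W" "smooth_fun_on M W f" "smooth_fun_on M W h"
proof -
  obtain V W where *: "p \<in> V" "p \<in> W" "smooth_fun_on M V f" "smooth_fun_on M W h"
    using assms by (auto simp: smooth_near_def)
  then have "smooth_fun_on M (V \<inter> W) f" "smooth_fun_on M (V \<inter> W) h"
    using smooth_fun_on_subset[of M V f "V \<inter> W"] smooth_fun_on_subset[of M W h "V \<inter> W"]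
      smooth_fun_on_openin[OF *(3)] smooth_fun_on_openin[OF *(4)] by (simp_all add: openin_Int)
  with * that[of "V \<inter> W"] show ?thesis by auto
qed

lemma smooth_near_bilinear:
  assumes "bounded_bilinear pr" "smooth_near M p f" "smooth_near M p h"
  shows "smooth_near M p (\<lambda>q. pr (f q) (h q))"
proof -
  obtain W where "p \<in> W" "smooth_fun_on M W f" "smooth_fun_on M W h"
    using smooth_near_common[OF assms(2,3)] .
  then show ?thesis using smooth_nearI[OF smooth_fun_on_bilinear[OF assms(1)]] by blast
qed

lemma smooth_near_add:
  assumes "smooth_near M p f" "smooth_near M p h"
  shows "smooth_near M p (\<lambda>q. f q + h q)"
proof -
  obtain W where "p \<in> W" "smooth_fun_on M W f" "smooth_fun_on M W h"
    using smooth_near_common[OF assms] .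
  then show ?thesis using smooth_nearI[OF smooth_fun_on_add] by blast
qed

lemma smooth_near_const: "p \<in> points M \<Longrightarrow> smooth_near M p (\<lambda>q. c)"
  by (rule smooth_nearI[OF smooth_fun_on_const[OF openin_points_self]])

lemmas smooth_near_inner = smooth_near_bilinear[OF bounded_bilinear_inner]
lemmas smooth_near_inner_const = smooth_near_linear[OF bounded_linear_inner_left]

lemma smooth_near_differentiable:
  assumes "smooth_near M p f" "(U, \<phi>) \<in> charts M" "p \<in> U"
  shows "((f \<circ> inv_into U \<phi>) has_derivative frechet_derivative (f \<circ> inv_into U \<phi>) (at (\<phi> p))) (at (\<phi> p))"
proof -
  obtain W where "p \<in> W" "smooth_fun_on M W f" using assms(1) by (auto simp: smooth_near_def)
  then show ?thesis
    using smooth_fun_onD[OF _ assms(2), of W f "Suc 0"] Ck_on_SucD assms(3) by blast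
qed

lemma chart_derivative_cong:
  assumes "openin (mtop M) W" "p \<in> W" "\<And>q. q \<in> W \<Longrightarrow> f q = h q" "(U, \<phi>) \<in> charts M" "p \<in> U"
  shows "frechet_derivative (f \<circ> inv_into U \<phi>) (at (\<phi> p)) = frechet_derivative (h \<circ> inv_into U \<phi>) (at (\<phi> p))"
  by (rule frechet_derivative_cong_open[OF chart_open[OF assms(4,1)]])
    (auto simp: assms inv_chart[OF assms(4)])

lemma tangent_space_subset_points: "v \<in> tangent_space M p \<Longrightarrow> p \<in> points M"
  using chart_subset by (auto simp: tangent_space_def)

lemma tangent_space_alt:
  "v \<in> tangent_space M p \<longleftrightarrow> (\<exists>U \<phi> w. (U, \<phi>) \<in> charts M \<and> p \<in> U \<and> v = chart_vec M U \<phi> p w)"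
  unfolding tangent_space_def chart_vec_def by auto

lemma chart_vec_change:
  assumes c: "(U, \<phi>) \<in> charts M" "p \<in> U" and d: "(V, \<psi>) \<in> charts M" "p \<in> V"
  shows "chart_vec M U \<phi> p w = chart_vec M V \<psi> p (frechet_derivative (\<psi> \<circ> inv_into U \<phi>) (at (\<phi> p)) w)"
proof
  fix f
  show "chart_vec M U \<phi> p w f = chart_vec M V \<psi> p (frechet_derivative (\<psi> \<circ> inv_into U \<phi>) (at (\<phi> p)) w) f"
  proof (cases "smooth_near M p f")
    case True
    have 1: "((\<psi> \<circ> inv_into U \<phi>) has_derivative frechet_derivative (\<psi> \<circ> inv_into U \<phi>) (at (\<phi> p))) (at (\<phi> p))"
      using chart_transition[OF c(1) d(1), of "Suc 0"] Ck_on_SucD c d by blast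
    have "((f \<circ> inv_into V \<psi>) has_derivative frechet_derivative (f \<circ> inv_into V \<psi>) (at (\<psi> p)))
        (at ((\<psi> \<circ> inv_into U \<phi>) (\<phi> p)))"
      using smooth_near_differentiable[OF True d] by (simp add: inv_chart[OF c])
    from diff_chain_at[OF 1 this]
    have "((f \<circ> inv_into U \<phi>) has_derivative frechet_derivative (f \<circ> inv_into V \<psi>) (at (\<psi> p)) \<circ>
       frechet_derivative (\<psi> \<circ> inv_into U \<phi>) (at (\<phi> p))) (at (\<phi> p))"
      by (rule has_derivative_transform_within_open[OF _ chart_open[OF c(1) chart_openin[OF d(1)]]])
        (use c d in \<open>auto simp: inv_chart[OF c(1)] inv_chart[OF d(1)]\<close>)
    from frechet_derivative_at[OF this, symmetric] show ?thesis
      by (simp add: chart_vec_def True)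
  qed (simp add: chart_vec_def)
qed

text \<open>A tangent vector may be presented in any chart around its base point; a sum of two tangent vectors
can be formed only after both have been moved to a common chart.\<close>

lemma tangent_space_chart:
  assumes "(U, \<phi>) \<in> charts M" "p \<in> U"
  shows "tangent_space M p = range (chart_vec M U \<phi> p)"
proof
  show "tangent_space M p \<subseteq> range (chart_vec M U \<phi> p)"
    using chart_vec_change[OF _ _ assms] by (fastforce simp: tangent_space_alt)
  show "range (chart_vec M U \<phi> p) \<subseteq> tangent_space M p"
    using assms tangent_space_alt by blast
qed

lemma chart_vec_tlincomb:
  assumes "(U, \<phi>) \<in> charts M" "p \<in> U"
  shows "tlincomb a (chart_vec M U \<phi> p v) b (chart_vec M U \<phi> p w) = chart_vec M U \<phi> p (a *\<^sub>R v + b *\<^sub>R w)"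
proof
  fix f
  show "tlincomb a (chart_vec M U \<phi> p v) b (chart_vec M U \<phi> p w) f =
      chart_vec M U \<phi> p (a *\<^sub>R v + b *\<^sub>R w) f"
  proof (cases "smooth_near M p f")
    case True
    from has_derivative_linear[OF smooth_near_differentiable[OF True assms]] True show ?thesis
      by (simp add: tlincomb_def chart_vec_def linear_add linear_cmul)
  qed (simp add: tlincomb_def chart_vec_def)
qed

lemma tangent_space_tlincomb:
  assumes "u \<in> tangent_space M p" "v \<in> tangent_space M p"
  shows "tlincomb a u b v \<in> tangent_space M p"
proof -
  obtain U \<phi> where c: "(U, \<phi>) \<in> charts M" "p \<in> U" 
    using assms(1) by (auto simp: tangent_space_alt)
  show ?thesis
    using assms chart_vec_tlincomb[OF c] by (auto simp: tangent_space_chart[OF c])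
qed

lemma tangent_space_zero:
  assumes "p \<in> points M" shows "(\<lambda>f. 0) \<in> tangent_space M p"
proof -
  obtain U \<phi> where c: "(U, \<phi>) \<in> charts M" "p \<in> U" using chart_cover[OF assms] .
  have "tlincomb 0 (chart_vec M U \<phi> p 0) 0 (chart_vec M U \<phi> p 0) \<in> tangent_space M p"
    by (rule tangent_space_tlincomb) (auto simp: tangent_space_chart[OF c])
  then show ?thesis by (simp add: tlincomb_def)
qed

lemma vderiv_chart_vec:
  assumes c: "(U, \<phi>) \<in> charts M" "p \<in> U" and F: "smooth_near M p F"
  shows "vderiv (chart_vec M U \<phi> p w) F = frechet_derivative (F \<circ> inv_into U \<phi>) (at (\<phi> p)) w"
proof -
  have "chart_vec M U \<phi> p w (\<lambda>q. F q \<bullet> i) = frechet_derivative (F \<circ> inv_into U \<phi>) (at (\<phi> p)) w \<bullet> i" for i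
  proof -
    have "((\<lambda>y. (F \<circ> inv_into U \<phi>) y \<bullet> i) has_derivative
        (\<lambda>v. frechet_derivative (F \<circ> inv_into U \<phi>) (at (\<phi> p)) v \<bullet> i)) (at (\<phi> p))"
      by (rule has_derivative_inner_left[OF smooth_near_differentiable[OF F c]])
    from frechet_derivative_at[OF this, symmetric]
    show ?thesis by (simp add: chart_vec_def smooth_near_inner_const[OF F] o_def)
  qed
  then show ?thesis by (simp add: vderiv_def euclidean_representation)
qed

lemma tangent_vector_cases:
  assumes "v \<in> tangent_space M p"
  obtains U \<phi> w where "(U, \<phi>) \<in> charts M" "p \<in> U" "v = chart_vec M U \<phi> p w"
  using assms by (auto simp: tangent_space_alt)

text \<open>Through this lemma and \<open>vderiv_eqI\<close> the rules of the differential calculus in normed spaces carry over to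
tangent vectors.\<close>

lemma vderiv_has_derivative:
  assumes "(U, \<phi>) \<in> charts M" "p \<in> U" "smooth_near M p F"
  shows "((F \<circ> inv_into U \<phi>) has_derivative (\<lambda>w. vderiv (chart_vec M U \<phi> p w) F)) (at (\<phi> p))"
  using smooth_near_differentiable[OF assms(3,1,2)] vderiv_chart_vec[OF assms] by simp

lemma vderiv_eqI:
  assumes c: "(U, \<phi>) \<in> charts M" "p \<in> U" and F: "smooth_near M p F"
    and D: "((F \<circ> inv_into U \<phi>) has_derivative D) (at (\<phi> p))"
  shows "vderiv (chart_vec M U \<phi> p w) F = D w"
  using has_derivative_unique[OF vderiv_has_derivative[OF c F] D] by meson

lemma vderiv_linear:
  assumes L: "bounded_linear L" and v: "v \<in> tangent_space M p" and F: "smooth_near M p F"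
  shows "vderiv v (\<lambda>q. L (F q)) = L (vderiv v F)"
proof -
  obtain U \<phi> w where c: "(U, \<phi>) \<in> charts M" "p \<in> U" and vw: "v = chart_vec M U \<phi> p w"
    using tangent_vector_cases[OF v] .
  show ?thesis unfolding vw
    by (rule vderiv_eqI[OF c smooth_near_linear[OF L F]])
      (use bounded_linear.has_derivative[OF L vderiv_has_derivative[OF c F]] in \<open>simp add: o_def\<close>)
qed

lemma vderiv_add:
  assumes v: "v \<in> tangent_space M p" and F: "smooth_near M p F" and G: "smooth_near M p G"
  shows "vderiv v (\<lambda>q. F q + G q) = vderiv v F + vderiv v G"
proof -
  obtain U \<phi> w where c: "(U, \<phi>) \<in> charts M" "p \<in> U" and vw: "v = chart_vec M U \<phi> p w"
    using tangent_vector_cases[OF v] .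
  show ?thesis unfolding vw
    by (rule vderiv_eqI[OF c smooth_near_add[OF F G]])
      (use has_derivative_add[OF vderiv_has_derivative[OF c F] vderiv_has_derivative[OF c G]]
        in \<open>simp add: o_def\<close>)
qed

lemma vderiv_bilinear:
  assumes pr: "bounded_bilinear pr" and v: "v \<in> tangent_space M p"
    and F: "smooth_near M p F" and G: "smooth_near M p G"
  shows "vderiv v (\<lambda>q. pr (F q) (G q)) = pr (F p) (vderiv v G) + pr (vderiv v F) (G p)"
proof -
  obtain U \<phi> w where c: "(U, \<phi>) \<in> charts M" "p \<in> U" and vw: "v = chart_vec M U \<phi> p w"
    using tangent_vector_cases[OF v] .
  show ?thesis unfolding vw
    by (rule vderiv_eqI[OF c smooth_near_bilinear[OF pr F G]])
      (use bounded_bilinear.FDERIV[OF pr vderiv_has_derivative[OF c F] vderiv_has_derivative[OF c G]]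
        in \<open>simp add: o_def inv_chart[OF c]\<close>)
qed

lemma vderiv_const:
  assumes v: "v \<in> tangent_space M p" shows "vderiv v (\<lambda>q. c) = 0"
proof -
  obtain U \<phi> w where c: "(U, \<phi>) \<in> charts M" "p \<in> U" and vw: "v = chart_vec M U \<phi> p w"
    using tangent_vector_cases[OF v] .
  show ?thesis unfolding vw
    by (rule vderiv_eqI[OF c smooth_near_const]) (use c chart_subset in \<open>auto simp: o_def\<close>)
qed

lemma vderiv_inner:
  "v \<in> tangent_space M p \<Longrightarrow> smooth_near M p F \<Longrightarrow> smooth_near M p G \<Longrightarrow>
    vderiv v (\<lambda>q. F q \<bullet> G q) = F p \<bullet> vderiv v G + vderiv v F \<bullet> G p"
  by (rule vderiv_bilinear[OF bounded_bilinear_inner])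

lemma vderiv_scaleR:
  "v \<in> tangent_space M p \<Longrightarrow> smooth_near M p F \<Longrightarrow> smooth_near M p G \<Longrightarrow>
    vderiv v (\<lambda>q. F q *\<^sub>R G q) = F p *\<^sub>R vderiv v G + vderiv v F *\<^sub>R G p"
  by (rule vderiv_bilinear[OF bounded_bilinear_scaleR])

lemma vderiv_sum:
  assumes v: "v \<in> tangent_space M p" and F: "\<And>i. i \<in> I \<Longrightarrow> smooth_near M p (F i)"
  shows "vderiv v (\<lambda>q. \<Sum>i\<in>I. F i q) = (\<Sum>i\<in>I. vderiv v (F i)) \<and> smooth_near M p (\<lambda>q. \<Sum>i\<in>I. F i q)"
  using F
proof (induction I rule: infinite_finite_induct)
  case (insert i I)
  then show ?case by (simp add: vderiv_add[OF v] smooth_near_add)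
qed (simp_all add: vderiv_const[OF v] smooth_near_const[OF tangent_space_subset_points[OF v]])

text \<open>Tangent vectors depend only on the germ of a function, also for functions that are not smooth:
agreement near \<open>p\<close> makes both smooth near \<open>p\<close> or neither, and in the second case both values are \<open>0\<close>.\<close>

lemma tangent_vector_cong:
  assumes v: "v \<in> tangent_space M p"
    and W: "openin (mtop M) W" "p \<in> W" "\<And>q. q \<in> W \<Longrightarrow> f q = h q"
  shows "v f = v h"
proof -
  obtain U \<phi> w where c: "(U, \<phi>) \<in> charts M" "p \<in> U" and vw: "v = chart_vec M U \<phi> p w"
    using tangent_vector_cases[OF v] .
  show ?thesis
    using smooth_near_cong[where f = f and h = h, OF W]
      chart_derivative_cong[where f = f and h = h, OF W c] by (simp add: vw chart_vec_def)
qed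

lemma vderiv_cong:
  assumes v: "v \<in> tangent_space M p"
    and W: "openin (mtop M) W" "p \<in> W" "\<And>q. q \<in> W \<Longrightarrow> F q = G q"
  shows "vderiv v F = vderiv v G"
  unfolding vderiv_def
  by (rule sum.cong[OF refl], rule arg_cong[where f = "\<lambda>c. c *\<^sub>R _"], rule tangent_vector_cong[OF v W(1,2)])
    (simp add: W(3))

lemma vector_field_smooth:
  assumes X: "vector_field M X" and F: "smooth_fun_on M W F"
  shows "smooth_fun_on M W (\<lambda>q. vderiv (X q) F)"
  unfolding vderiv_def
proof (rule smooth_fun_on_sum[OF smooth_fun_on_openin[OF F]])
  fix i
  have "smooth_fun_on M W (\<lambda>q. X q (\<lambda>q'. F q' \<bullet> i))"
    using X smooth_fun_on_inner_const[OF F] by (simp add: vector_field_def)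
  then show "smooth_fun_on M W (\<lambda>q. X q (\<lambda>q'. F q' \<bullet> i) *\<^sub>R i)"
    by (rule smooth_fun_on_linear[OF bounded_linear_scaleR_left])
qed

lemma vector_field_smooth_near:
  assumes "vector_field M X" "smooth_near M p F"
  shows "smooth_near M p (\<lambda>q. vderiv (X q) F)"
proof -
  obtain W where "p \<in> W" "smooth_fun_on M W F" using assms(2) by (auto simp: smooth_near_def)
  then show ?thesis using smooth_nearI[OF vector_field_smooth[OF assms(1)]] by blast
qed

lemma vector_field_tangent: "vector_field M X \<Longrightarrow> p \<in> points M \<Longrightarrow> X p \<in> tangent_space M p"
  by (simp add: vector_field_def)

lemma vector_field_diff:
  assumes "vector_field M X" "vector_field M Y"
  shows "vector_field M (vf_diff X Y)"
  unfolding vector_field_def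
proof (intro conjI ballI allI impI)
  fix p assume "p \<in> points M"
  then show "vf_diff X Y p \<in> tangent_space M p"
    unfolding vf_diff_tlincomb by (intro tangent_space_tlincomb vector_field_tangent assms)
next
  fix W f assume "smooth_fun_on M W (f :: 'a \<Rightarrow> real)"
  then show "smooth_fun_on M W (\<lambda>p. vf_diff X Y p f)"
    using assms smooth_fun_on_diff[of W "\<lambda>p. X p f" "\<lambda>p. Y p f"] by (simp add: vf_diff_def vector_field_def)
qed

lemma vector_field_scale:
  assumes h: "smooth_fun_on M (points M) h" and X: "vector_field M X"
  shows "vector_field M (vf_scale h X)"
  unfolding vector_field_def
proof (intro conjI ballI allI impI)
  fix p assume "p \<in> points M"
  then have "tlincomb (h p) (X p) 0 (X p) \<in> tangent_space M p"
    by (intro tangent_space_tlincomb vector_field_tangent[OF X])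
  then show "vf_scale h X p \<in> tangent_space M p" by (simp add: vf_scale_def tlincomb_def)
next
  fix W f assume f: "smooth_fun_on M W (f :: 'a \<Rightarrow> real)"
  have "smooth_fun_on M W h"
    using smooth_fun_on_subset[OF h smooth_fun_on_openin[OF f]] openin_points[OF smooth_fun_on_openin[OF f]]
    by blast
  then show "smooth_fun_on M W (\<lambda>p. vf_scale h X p f)"
    using smooth_fun_on_bilinear[OF bounded_bilinear_mult, of W h "\<lambda>p. X p f"] X f
    by (simp add: vf_scale_def vector_field_def)
qed

lemma vector_field_cong:
  assumes X: "vector_field M X" and eq: "\<And>p. p \<in> points M \<Longrightarrow> X p = Y p"
  shows "vector_field M Y"
proof -
  have "smooth_fun_on M W (\<lambda>p. Y p f)" if f: "smooth_fun_on M W f" for W f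
  proof (rule smooth_fun_on_cong)
    show "smooth_fun_on M W (\<lambda>p. X p f)" using X f by (simp add: vector_field_def)
    show "X q f = Y q f" if "q \<in> W" for q
      using eq openin_points[OF smooth_fun_on_openin[OF f] that] by simp
  qed
  then show ?thesis using X eq by (simp add: vector_field_def)
qed

text \<open>The bracket needs smoothness of \<open>F\<close> near \<open>p\<close>, since it is defined to be \<open>0\<close> on all other functions.\<close>

lemma vderiv_lie_bracket:
  assumes F: "smooth_near M p F"
  shows "vderiv (lie_bracket M X Y p) F = der X (der Y F) p - der Y (der X F) p"
proof (rule euclidean_eqI)
  fix i :: 'c assume i: "i \<in> Basis"
  show "vderiv (lie_bracket M X Y p) F \<bullet> i = (der X (der Y F) p - der Y (der X F) p) \<bullet> i"
    using smooth_near_inner_const[OF F, of i]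
    by (simp add: vderiv_inner_Basis[OF i] lie_bracket_def inner_diff_left)
qed

end

section \<open>Linear algebra in codimension one\<close>

text \<open>With \<open>\<tau>\<close> the trace of \<open>h\<close> and \<open>h k k \<noteq> 0\<close>, the rank condition makes \<open>\<xi>\<close> a multiple of the row
\<open>h k\<close>, which is an eigenvector of \<open>h\<close> for the eigenvalue \<open>\<tau>\<close>. The hypothesis \<open>eig\<close> asks for the
eigenvalue \<open>- \<tau> / 2\<close> instead, so the multiple is \<open>0\<close>.\<close>

lemma rank_one_gradient_zero:
  fixes h :: "'i \<Rightarrow> 'i \<Rightarrow> real"
  assumes "finite I" and tr: "(\<Sum>i\<in>I. h i i) \<noteq> 0"
    and rank: "\<And>i j k. i \<in> I \<Longrightarrow> j \<in> I \<Longrightarrow> k \<in> I \<Longrightarrow> h k k * h i j = h i k * h k j"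
    and eig: "\<And>j. j \<in> I \<Longrightarrow> 2 * (\<Sum>i\<in>I. \<xi> i * h i j) = - (\<Sum>i\<in>I. h i i) * \<xi> j"
    and j: "j \<in> I"
  shows "\<xi> j = 0"
proof -
  define \<tau> where "\<tau> = (\<Sum>i\<in>I. h i i)"
  obtain k where k: "k \<in> I" "h k k \<noteq> 0" using tr by (meson sum.neutral)
  define s where "s = (\<Sum>i\<in>I. \<xi> i * h i k)"
  have 1: "\<tau> * h k k * \<xi> l = - (2 * s * h k l)" if l: "l \<in> I" for l
  proof -
    have "h k k * (\<Sum>i\<in>I. \<xi> i * h i l) = (\<Sum>i\<in>I. \<xi> i * (h i k * h k l))"
      unfolding sum_distrib_left
    proof (rule sum.cong[OF refl])
      fix i assume i: "i \<in> I"
      have "h k k * (\<xi> i * h i l) = \<xi> i * (h k k * h i l)" by simp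
      then show "h k k * (\<xi> i * h i l) = \<xi> i * (h i k * h k l)" unfolding rank[OF i l k(1)] .
    qed
    also have "\<dots> = s * h k l" by (simp add: s_def sum_distrib_right mult.assoc)
    finally have "h k k * (2 * (\<Sum>i\<in>I. \<xi> i * h i l)) = 2 * s * h k l" by simp
    then show ?thesis unfolding eig[OF l] by (simp add: \<tau>_def algebra_simps)
  qed
  have "\<tau> * h k k * s = (\<Sum>l\<in>I. (\<tau> * h k k * \<xi> l) * h l k)"
    by (simp add: s_def sum_distrib_left mult.assoc)
  also have "\<dots> = (\<Sum>l\<in>I. - (2 * s) * (h l k * h k l))"
  proof (rule sum.cong[OF refl])
    fix l assume l: "l \<in> I"
    show "\<tau> * h k k * \<xi> l * h l k = - (2 * s) * (h l k * h k l)"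
      unfolding 1[OF l] by simp
  qed
  also have "\<dots> = (\<Sum>l\<in>I. - (2 * s) * (h k k * h l l))"
  proof (rule sum.cong[OF refl])
    fix l assume "l \<in> I"
    then show "- (2 * s) * (h l k * h k l) = - (2 * s) * (h k k * h l l)"
      by (simp only: rank[OF _ _ k(1), symmetric])
  qed
  also have "\<dots> = - (2 * s) * h k k * \<tau>"
    by (simp add: \<tau>_def sum_distrib_left mult.assoc)
  finally have "s = 0" using tr k(2) by (simp add: \<tau>_def)
  then show ?thesis using 1[OF j] tr k(2) by (simp add: \<tau>_def)
qed

lemma dim_range_linear_inj:
  fixes T :: "'b::euclidean_space \<Rightarrow> 'e::euclidean_space"
  assumes "linear T" "inj T"
  shows "dim (range T) = DIM('b)"
proof -
  have "independent (T ` Basis)"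
    using linear_independent_injective_image[OF assms(1) independent_Basis] assms(2)
    by (simp add: inj_on_subset)
  moreover have "range T = span (T ` Basis)"
    using linear_span_image[OF assms(1), of Basis] by simp
  moreover have "card (T ` Basis) = DIM('b)"
    by (rule card_image) (use assms(2) inj_on_subset in blast)
  ultimately show ?thesis using dim_span_eq_card_independent by metis
qed

lemma orthonormal_expansion:
  fixes a :: "'b::euclidean_space \<Rightarrow> 'e::euclidean_space"
  assumes dim: "DIM('e) = DIM('b) + 1"
    and a: "\<And>i j. i \<in> Basis \<Longrightarrow> j \<in> Basis \<Longrightarrow> a i \<bullet> a j = (if i = j then 1 else 0)"
    and n: "n \<bullet> n = 1" and an: "\<And>i. i \<in> Basis \<Longrightarrow> a i \<bullet> n = 0"
  shows "c = (\<Sum>i\<in>Basis. (c \<bullet> a i) *\<^sub>R a i) + (c \<bullet> n) *\<^sub>R n"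
proof -
  let ?B = "insert n (a ` Basis)"
  have "pairwise orthogonal ?B"
    using a an by (auto simp: pairwise_def orthogonal_def inner_commute split: if_splits)
  moreover have "0 \<notin> ?B" using a n by (auto simp: image_iff) (metis inner_zero_left zero_neq_one)+
  ultimately have ind: "independent ?B" by (rule pairwise_orthogonal_independent)
  have inj: "inj_on a Basis" by (rule inj_onI) (metis a zero_neq_one)
  have "n \<notin> a ` Basis" using an n by force
  then have "card ?B = DIM('e)" by (simp add: card_image[OF inj] dim)
  then have span: "span ?B = UNIV"
    using ind by (metis dim_eq_card_independent dim_eq_full)
  define r where "r = c - ((\<Sum>i\<in>Basis. (c \<bullet> a i) *\<^sub>R a i) + (c \<bullet> n) *\<^sub>R n)"
  have "orthogonal r b" if "b \<in> ?B" for b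
  proof -
    have "r \<bullet> n = 0"
      by (simp add: r_def inner_diff_left inner_add_left inner_sum_left an n)
    moreover have "r \<bullet> a j = 0" if "j \<in> Basis" for j
    proof -
      have "(\<Sum>i\<in>Basis. (c \<bullet> a i) * (a i \<bullet> a j)) = (\<Sum>i\<in>Basis. if i = j then c \<bullet> a i else 0)"
        by (rule sum.cong) (use a that in auto)
      also have "\<dots> = c \<bullet> a j" using that by simp
      finally show ?thesis
        using an[OF that] by (simp add: r_def inner_diff_left inner_add_left inner_sum_left inner_commute[of n])
    qed
    ultimately show ?thesis using that by (auto simp: orthogonal_def)
  qed
  then have "orthogonal r r" using orthogonal_to_span[of r ?B r] span by blast
  then show ?thesis by (simp add: r_def orthogonal_def)
qed

lemma trace_orthonormal:
  fixes a :: "'b::euclidean_space \<Rightarrow> 'e::euclidean_space"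
  assumes dim: "DIM('e) = DIM('b) + 1"
    and a: "\<And>i j. i \<in> Basis \<Longrightarrow> j \<in> Basis \<Longrightarrow> a i \<bullet> a j = (if i = j then 1 else 0)"
    and n: "n \<bullet> n = 1" and an: "\<And>i. i \<in> Basis \<Longrightarrow> a i \<bullet> n = 0"
    and K: "linear K"
  shows "(\<Sum>i\<in>Basis. K (a i) \<bullet> a i) + K n \<bullet> n = (\<Sum>c\<in>Basis. K c \<bullet> c)"
proof -
  have *: "(\<Sum>c\<in>Basis. (c \<bullet> u) * (K c \<bullet> u)) = K u \<bullet> u" for u
  proof -
    have "K u \<bullet> u = (\<Sum>c\<in>Basis. (u \<bullet> c) *\<^sub>R K c) \<bullet> u" using linear_sum_Basis[OF K, of u] by simp
    then show ?thesis by (simp add: inner_commute inner_sum_right)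
  qed
  have "(\<Sum>c\<in>Basis. K c \<bullet> c) = (\<Sum>c\<in>Basis. K c \<bullet> ((\<Sum>i\<in>Basis. (c \<bullet> a i) *\<^sub>R a i) + (c \<bullet> n) *\<^sub>R n))"
    using orthonormal_expansion[OF dim a n an] by metis
  also have "\<dots> = (\<Sum>c\<in>Basis. \<Sum>i\<in>Basis. (c \<bullet> a i) * (K c \<bullet> a i)) + (\<Sum>c\<in>Basis. (c \<bullet> n) * (K c \<bullet> n))"
    by (simp add: inner_add_right inner_sum_right sum.distrib)
  also have "(\<Sum>c\<in>Basis. \<Sum>i\<in>Basis. (c \<bullet> a i) * (K c \<bullet> a i)) = (\<Sum>i\<in>Basis. K (a i) \<bullet> a i)"
    by (subst sum.swap) (simp add: *)
  finally show ?thesis by (simp add: *)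
qed

section \<open>Tangential parts of constant vectors\<close>

locale immersed_mfd = smooth_mfd M for M :: "('a, 'b::euclidean_space) manifold" +
  fixes g :: "'a metric_tensor" and x :: "'a \<Rightarrow> 'e::euclidean_space"
  assumes immersion: "isometric_immersion M g x"
begin

definition tangential :: "'e \<Rightarrow> 'a vfield" where
  "tangential a p = (THE v. v \<in> tangent_space M p \<and>
     (\<forall>w\<in>tangent_space M p. (a - vderiv v x) \<bullet> vderiv w x = 0))"

lemma x_smooth: "smooth_fun_on M (points M) x"
  using immersion by (simp add: isometric_immersion_def)

lemma x_smooth_near: "p \<in> points M \<Longrightarrow> smooth_near M p x"
  by (rule smooth_nearI[OF x_smooth])

lemma g_eq:
  "v \<in> tangent_space M p \<Longrightarrow> w \<in> tangent_space M p \<Longrightarrow> g p v w = vderiv v x \<bullet> vderiv w x"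
  using immersion tangent_space_subset_points by (simp add: isometric_immersion_def)

text \<open>Testing against tangent vectors is enough because the difference of \<open>u\<close> and \<open>v\<close> may be used as
test vector and the differential of \<open>x\<close> is injective.\<close>

lemma tangent_eqI:
  assumes u: "u \<in> tangent_space M p" and v: "v \<in> tangent_space M p"
    and eq: "\<And>w. w \<in> tangent_space M p \<Longrightarrow> vderiv u x \<bullet> vderiv w x = vderiv v x \<bullet> vderiv w x"
  shows "u = v"
proof -
  have d: "tlincomb 1 u (-1) v \<in> tangent_space M p" by (rule tangent_space_tlincomb[OF u v])
  have "vderiv (tlincomb 1 u (-1) v) x \<bullet> vderiv (tlincomb 1 u (-1) v) x = 0"
    using eq[OF d] by (simp add: vderiv_tlincomb inner_diff_left)
  then have "vderiv u x = vderiv v x" by (simp add: vderiv_tlincomb)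
  then show ?thesis
    using immersion u v tangent_space_subset_points[OF u]
    by (auto simp: isometric_immersion_def inj_on_def)
qed

lemma tangent_eqI_dx:
  assumes "u \<in> tangent_space M p" "v \<in> tangent_space M p" "vderiv u x = vderiv v x"
  shows "u = v"
  using tangent_eqI[OF assms(1,2)] assms(3) by simp

lemma chart_smooth: "(U, \<phi>) \<in> charts M \<Longrightarrow> smooth_fun_on M U \<phi>"
  by (rule smooth_fun_onI[OF chart_openin chart_transition])

text \<open>Differentiating the coordinate map itself recovers the coordinate vector \<open>w\<close>; this is why
  a tangent space has the full dimension of the model space.\<close>

lemma chart_vec_inj:
  assumes c: "(U, \<phi>) \<in> charts M" "p \<in> U" shows "inj (chart_vec M U \<phi> p)"
proof -
  have "vderiv (chart_vec M U \<phi> p w) \<phi> = w" for w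
  proof (rule vderiv_eqI[OF c smooth_nearI[OF chart_smooth[OF c(1)] c(2)]])
    have "open (\<phi> ` U)" using chart_open[OF c(1) chart_openin[OF c(1)]] by simp
    then show "((\<phi> \<circ> inv_into U \<phi>) has_derivative (\<lambda>w. w)) (at (\<phi> p))"
      by (rule has_derivative_transform_within_open[OF has_derivative_ident])
        (use c in \<open>auto simp: inv_chart\<close>)
  qed
  then show ?thesis by (metis injI)
qed

lemma dx_chart_linear:
  assumes c: "(U, \<phi>) \<in> charts M" "p \<in> U"
  shows "linear (\<lambda>w. vderiv (chart_vec M U \<phi> p w) x)"
  using c chart_subset
  by (intro has_derivative_linear[OF vderiv_has_derivative[OF c x_smooth_near]]) auto

lemma dx_chart_inj:
  assumes c: "(U, \<phi>) \<in> charts M" "p \<in> U"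
  shows "inj (\<lambda>w. vderiv (chart_vec M U \<phi> p w) x)"
proof (rule injI)
  fix v w assume "vderiv (chart_vec M U \<phi> p v) x = vderiv (chart_vec M U \<phi> p w) x"
  then have "chart_vec M U \<phi> p v = chart_vec M U \<phi> p w"
    by (intro tangent_eqI_dx[where p = p]) (auto simp: tangent_space_chart[OF c])
  then show "v = w" using chart_vec_inj[OF c] by (simp add: inj_def)
qed

lemma dx_image:
  assumes "p \<in> points M"
  shows "subspace ((\<lambda>v. vderiv v x) ` tangent_space M p)"
    and "dim ((\<lambda>v. vderiv v x) ` tangent_space M p) = DIM('b)"
proof -
  obtain U \<phi> where c: "(U, \<phi>) \<in> charts M" "p \<in> U" using chart_cover[OF assms] .
  have eq: "(\<lambda>v. vderiv v x) ` tangent_space M p = range (\<lambda>w. vderiv (chart_vec M U \<phi> p w) x)"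
    by (auto simp: tangent_space_chart[OF c])
  show "subspace ((\<lambda>v. vderiv v x) ` tangent_space M p)"
    unfolding eq by (rule linear_subspace_image[OF dx_chart_linear[OF c] subspace_UNIV])
  show "dim ((\<lambda>v. vderiv v x) ` tangent_space M p) = DIM('b)"
    unfolding eq by (rule dim_range_linear_inj[OF dx_chart_linear[OF c] dx_chart_inj[OF c]])
qed

lemma tangential_unique:
  assumes "v \<in> tangent_space M p" "\<And>w. w \<in> tangent_space M p \<Longrightarrow> (a - vderiv v x) \<bullet> vderiv w x = 0"
  shows "tangential a p = v"
  unfolding tangential_def
proof (rule the_equality)
  fix u assume u: "u \<in> tangent_space M p \<and> (\<forall>w\<in>tangent_space M p. (a - vderiv u x) \<bullet> vderiv w x = 0)"
  show "u = v"
    by (rule tangent_eqI) (use u assms in \<open>auto simp: inner_diff_left\<close>)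
qed (use assms in auto)

lemma tangential:
  assumes p: "p \<in> points M"
  shows "tangential a p \<in> tangent_space M p"
    and "w \<in> tangent_space M p \<Longrightarrow> (a - vderiv (tangential a p) x) \<bullet> vderiv w x = 0"
proof -
  define S where "S = (\<lambda>v. vderiv v x) ` tangent_space M p"
  have S: "span S = S" using dx_image(1)[OF p] by (simp add: S_def span_eq_iff)
  obtain y z where y: "y \<in> span S" and z: "\<forall>w\<in>span S. orthogonal z w" and a: "a = y + z"
  proof (rule orthogonal_subspace_decomp_exists[of S a])
    fix y z assume "y \<in> span S" "\<And>w. w \<in> span S \<Longrightarrow> orthogonal z w" "a = y + z"
    then show thesis by (intro that) auto
  qed
  have "y \<in> S" using y S by simp
  then obtain v where v: "v \<in> tangent_space M p" "y = vderiv v x" by (auto simp: S_def)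
  have o: "(a - vderiv v x) \<bullet> vderiv w x = 0" if "w \<in> tangent_space M p" for w
  proof -
    have "vderiv w x \<in> span S" using that by (auto simp: S intro: imageI) (simp add: S_def)
    then show ?thesis using z v a by (simp add: orthogonal_def)
  qed
  have "tangential a p = v" by (rule tangential_unique[OF v(1) o])
  with v o show "tangential a p \<in> tangent_space M p"
    and "w \<in> tangent_space M p \<Longrightarrow> (a - vderiv (tangential a p) x) \<bullet> vderiv w x = 0" by auto
qed

lemma tangential_dx: "v \<in> tangent_space M p \<Longrightarrow> tangential (vderiv v x) p = v"
  by (rule tangential_unique) auto

lemma tangential_linear:
  assumes p: "p \<in> points M"
  shows "tangential (r *\<^sub>R a + s *\<^sub>R b) p = tlincomb r (tangential a p) s (tangential b p)"
proof (rule tangential_unique[OF tangent_space_tlincomb])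
  fix w assume w: "w \<in> tangent_space M p"
  have "r * ((a - vderiv (tangential a p) x) \<bullet> vderiv w x) +
      s * ((b - vderiv (tangential b p) x) \<bullet> vderiv w x) = 0"
    by (simp add: tangential(2)[OF p w])
  then show "(r *\<^sub>R a + s *\<^sub>R b - vderiv (tlincomb r (tangential a p) s (tangential b p)) x) \<bullet> vderiv w x = 0"
    by (simp add: vderiv_tlincomb inner_diff_left inner_add_left algebra_simps)
qed (rule tangential(1)[OF p])+

text \<open>In a chart the coordinates \<open>w\<close> of the tangential part of \<open>a\<close> satisfy \<open>G w = b\<close>, where \<open>G\<close> is the Gram
matrix of the vectors \<open>\<partial>\<^sub>i x\<close> and \<open>b\<close> has the entries \<open>a \<bullet> \<partial>\<^sub>i x\<close>. The coefficients are
smooth and \<open>G\<close> is injective because the differential of \<open>x\<close> is, so \<open>w\<close> is smooth.\<close>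

lemma tangential_vector_field: "vector_field M (tangential a)"
  unfolding vector_field_def
proof (intro conjI ballI allI impI)
  fix W and f :: "'a \<Rightarrow> real" assume f: "smooth_fun_on M W f"
  note W = smooth_fun_on_openin[OF f]
  show "smooth_fun_on M W (\<lambda>p. tangential a p f)"
  proof (rule smooth_fun_onI[OF W])
    fix U \<phi> k assume c: "(U, \<phi>) \<in> charts M"
    define S where "S = \<phi> ` (U \<inter> W)"
    have S: "open S" unfolding S_def by (rule chart_open[OF c W])
    define q where "q = inv_into U \<phi>"
    have q: "q y \<in> U" "q y \<in> W" "\<phi> (q y) = y" "q y \<in> points M" if "y \<in> S" for y
      using that c chart_subset[OF c] by (auto simp: q_def S_def inv_chart)
    define T where "T y w = vderiv (chart_vec M U \<phi> (q y) w) x" for y w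
    have T: "linear (T y)" "inj (T y)" if "y \<in> S" for y
      using dx_chart_linear[OF c q(1)[OF that]] dx_chart_inj[OF c q(1)[OF that]]
      by (simp_all add: T_def[abs_def])
    have T_smooth: "Ck_on j S (\<lambda>y. T y i)" for i j
    proof -
      have "Ck_on (Suc j) S (x \<circ> q)" 
        unfolding S_def q_def using openin_points[OF W]
        by (intro smooth_fun_onD[OF smooth_fun_on_subset[OF x_smooth W] c]) auto
      then have "Ck_on j S (\<lambda>y. frechet_derivative (x \<circ> q) (at y) i)" by simp
      then show ?thesis
      proof (rule Ck_on_cong[OF S])
        fix y assume y: "y \<in> S"
        show "frechet_derivative (x \<circ> q) (at y) i = T y i"
          using vderiv_chart_vec[OF c q(1)[OF y] x_smooth_near[OF q(4)[OF y]], of i] q(3)[OF y]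
          by (simp add: T_def q_def)
      qed
    qed
    \<comment> \<open>The Gram matrix of the coordinate vectors, as an operator.\<close>
    define G where "G y w = (\<Sum>i\<in>Basis. (T y w \<bullet> T y i) *\<^sub>R i)" for y w
    have lin: "linear (G y)" if "y \<in> S" for y
      by (rule linearI) (simp_all add: G_def linear_add[OF T(1)[OF that]] linear_cmul[OF T(1)[OF that]]
          inner_add_left scaleR_add_left sum.distrib scaleR_sum_right)
    have G_inner: "G y w \<bullet> w' = T y w \<bullet> T y w'" if "y \<in> S" for y w w'
      by (subst linear_sum_Basis[OF T(1)[OF that], of w'])
        (simp add: G_def inner_sum_left inner_sum_right inner_commute mult.commute)
    have inj: "inj (G y)" if y: "y \<in> S" for y
    proof -
      have "w = 0" if "G y w = 0" for w
      proof -
        have "T y w \<bullet> T y w = 0" using G_inner[OF y, of w w] that by simp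
        then show ?thesis using T[OF y] by (simp add: linear_injective_0)
      qed
      then show ?thesis using lin[OF y] by (simp add: linear_injective_0)
    qed
    have G_smooth: "Cinf_on S (\<lambda>y. G y w)" for w
      unfolding Cinf_on_def G_def
      by (intro allI Ck_on_sum S Ck_on_linear[OF bounded_linear_scaleR_left]
          Ck_on_bilinear[OF bounded_bilinear_inner] T_smooth finite_Basis)
    define w where "w y = (SOME w. chart_vec M U \<phi> (q y) w = tangential a (q y))" for y
    have w: "chart_vec M U \<phi> (q y) (w y) = tangential a (q y)" if y: "y \<in> S" for y
    proof -
      have "tangential a (q y) \<in> range (chart_vec M U \<phi> (q y))"
        using tangential(1)[OF q(4)[OF y]] tangent_space_chart[OF c q(1)[OF y]] by simp
      then have "\<exists>w. chart_vec M U \<phi> (q y) w = tangential a (q y)" by (auto simp: image_iff)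
      then show ?thesis unfolding w_def by (rule someI_ex)
    qed
    have w_smooth: "Ck_on k S w"
    proof (rule Ck_on_linear_system[OF S lin inj G_smooth])
      fix y assume y: "y \<in> S"
      have "(a - T y (w y)) \<bullet> T y i = 0" for i
        using tangential(2)[OF q(4)[OF y], of "chart_vec M U \<phi> (q y) i" a] w[OF y]
        by (simp add: T_def tangent_space_chart[OF c q(1)[OF y]])
      then show "G y (w y) = (\<Sum>i\<in>Basis. (a \<bullet> T y i) *\<^sub>R i)"
        by (simp add: G_def inner_diff_left)
    next
      show "Ck_on k S (\<lambda>y. \<Sum>i\<in>Basis. (a \<bullet> T y i) *\<^sub>R i)"
        by (intro allI Ck_on_sum S Ck_on_linear[OF bounded_linear_scaleR_left]
            Ck_on_linear[OF bounded_linear_inner_right] T_smooth finite_Basis)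
    qed
    have "Ck_on (Suc k) S (f \<circ> q)" using smooth_fun_onD[OF f c] by (simp add: S_def q_def)
    then have "Ck_on k S (\<lambda>y. \<Sum>i\<in>Basis. (w y \<bullet> i) *\<^sub>R frechet_derivative (f \<circ> q) (at y) i)"
      by (intro Ck_on_sum S Ck_on_bilinear[OF bounded_bilinear_scaleR]
          Ck_on_linear[OF bounded_linear_inner_left] w_smooth finite_Basis) simp
    then have "Ck_on k S ((\<lambda>p. tangential a p f) \<circ> q)"
    proof (rule Ck_on_cong[OF S])
      fix y assume y: "y \<in> S"
      have near: "smooth_near M (q y) f" by (rule smooth_nearI[OF f q(2)[OF y]])
      have "tangential a (q y) f = frechet_derivative (f \<circ> q) (at y) (w y)"
        using w[OF y, symmetric] near q(3)[OF y] by (simp add: chart_vec_def q_def)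
      also have "\<dots> = (\<Sum>i\<in>Basis. (w y \<bullet> i) *\<^sub>R frechet_derivative (f \<circ> q) (at y) i)"
        using has_derivative_linear[OF smooth_near_differentiable[OF near c q(1)[OF y]]] q(3)[OF y]
        by (intro linear_sum_Basis) (simp add: q_def)
      finally show "(\<Sum>i\<in>Basis. (w y \<bullet> i) *\<^sub>R frechet_derivative (f \<circ> q) (at y) i) =
          ((\<lambda>p. tangential a p f) \<circ> q) y" by simp
    qed
    then show "Ck_on k (\<phi> ` (U \<inter> W)) ((\<lambda>p. tangential a p f) \<circ> inv_into U \<phi>)"
      by (simp add: S_def q_def)
  qed
qed (rule tangential(1))

lemma orthonormal_at_exists:
  assumes p: "p \<in> points M" shows "\<exists>E. orthonormal_at M g p E"
proof -
  define S where "S = (\<lambda>v. vderiv v x) ` tangent_space M p"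
  obtain B where B: "B \<subseteq> S" "pairwise orthogonal B" "\<And>b. b \<in> B \<Longrightarrow> norm b = 1"
    "independent B" "card B = dim S"
  proof (rule orthonormal_basis_subspace[OF dx_image(1)[OF p]])
    fix B assume "B \<subseteq> (\<lambda>v. vderiv v x) ` tangent_space M p" "pairwise orthogonal B"
      "\<And>b. b \<in> B \<Longrightarrow> norm b = 1" "independent B"
      "card B = dim ((\<lambda>v. vderiv v x) ` tangent_space M p)"
    then show thesis by (intro that) (auto simp: S_def)
  qed
  have "finite B" using B(4) by (rule independent_imp_finite)
  moreover have "DIM('b) = card B" using B(5) dx_image(2)[OF p] by (simp add: S_def)
  ultimately obtain h where h: "bij_betw h (Basis :: 'b set) B"
    using finite_same_card_bij[OF finite_Basis] by blast
  have dx: "vderiv (tangential (h i) p) x = h i" if "i \<in> Basis" for i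
  proof -
    have "h i \<in> S" using B(1) h that by (auto simp: bij_betw_def)
    then show ?thesis using tangential_dx by (auto simp: S_def)
  qed
  have hB: "h i \<in> B" if "i \<in> Basis" for i using h that by (auto simp: bij_betw_def)
  have "h i \<bullet> h j = (if i = j then 1 else 0)" if "i \<in> Basis" "j \<in> Basis" for i j
  proof (cases "i = j")
    case True then show ?thesis using B(3)[OF hB] that by (simp add: norm_eq_1)
  next
    case False
    then have "h i \<noteq> h j" using h that inj_onD[OF bij_betw_imp_inj_on[OF h]] by blast
    then show ?thesis using pairwiseD[OF B(2) hB hB] that False by (simp add: orthogonal_def)
  qed
  then have "orthonormal_at M g p (\<lambda>i. tangential (h i))"
    by (simp add: orthonormal_at_def tangential_vector_field g_eq tangential(1)[OF p] dx)
  then show ?thesis by blast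
qed

text \<open>The frame chosen in the definition of the trace is orthonormal because orthonormal frames exist,
and it does not depend on the tensor.\<close>

lemma metric_trace_frame:
  assumes p: "p \<in> points M"
  shows "\<exists>E. orthonormal_at M g p E \<and> (\<forall>B. metric_trace M g p B = (\<Sum>i\<in>Basis. B (E i) (E i)))"
  using someI_ex[OF orthonormal_at_exists[OF p]] by (auto simp: metric_trace_def Let_def)

end

section \<open>The connection as tangential part of the flat derivative\<close>

locale levi_civita_immersion = immersed_mfd +
  fixes nabla :: "'a connection"
  assumes levi_civita: "levi_civita_connection M g nabla"
begin

lemma nabla_vector_field:
  "vector_field M X \<Longrightarrow> vector_field M Y \<Longrightarrow> vector_field M (nabla X Y)"
  using levi_civita by (simp add: levi_civita_connection_def affine_connection_def)

lemma torsion_free: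
  "vector_field M X \<Longrightarrow> vector_field M Y \<Longrightarrow> p \<in> points M \<Longrightarrow>
    lie_bracket M X Y p = vf_diff (nabla X Y) (nabla Y X) p"
  using levi_civita by (simp add: levi_civita_connection_def vf_eq_def)

lemma lie_bracket_vector_field:
  assumes "vector_field M X" "vector_field M Y"
  shows "vector_field M (lie_bracket M X Y)"
  by (rule vector_field_cong[OF vector_field_diff[OF nabla_vector_field[OF assms] nabla_vector_field[OF assms(2,1)]]])
    (simp add: torsion_free assms)

lemma x_der_smooth:
  "vector_field M X \<Longrightarrow> smooth_fun_on M (points M) (der X x)"
  by (rule vector_field_smooth[OF _ x_smooth])

lemma nabla_metric:
  assumes X: "vector_field M X" and Y: "vector_field M Y" and Z: "vector_field M Z"
    and p: "p \<in> points M"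
  shows "der X (der Y x) p \<bullet> der Z x p + der X (der Z x) p \<bullet> der Y x p =
    der (nabla X Y) x p \<bullet> der Z x p + der (nabla X Z) x p \<bullet> der Y x p"
proof -
  note T = vector_field_tangent[OF _ p]
  have "X p (\<lambda>q. g q (Y q) (Z q)) = X p (\<lambda>q. der Y x q \<bullet> der Z x q)"
    by (rule tangent_vector_cong[OF T[OF X] openin_points_self p])
      (simp add: g_eq vector_field_tangent Y Z)
  also have "\<dots> = vderiv (X p) (\<lambda>q. der Y x q \<bullet> der Z x q)" by (simp add: vderiv_real)
  also have "\<dots> = der Y x p \<bullet> der X (der Z x) p + der X (der Y x) p \<bullet> der Z x p"
    by (rule vderiv_bilinear[OF bounded_bilinear_inner T[OF X]
          smooth_nearI[OF x_der_smooth[OF Y] p] smooth_nearI[OF x_der_smooth[OF Z] p]])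
  finally have "der X (der Y x) p \<bullet> der Z x p + der Y x p \<bullet> der X (der Z x) p =
      g p (nabla X Y p) (Z p) + g p (Y p) (nabla X Z p)"
    using levi_civita X Y Z p by (simp add: levi_civita_connection_def)
  then show ?thesis
    using T[OF nabla_vector_field[OF X Y]] T[OF nabla_vector_field[OF X Z]] T[OF Y] T[OF Z]
    by (simp add: g_eq inner_commute)
qed

text \<open>Koszul's argument: the difference \<open>D\<close> of the two sides is symmetric in its first two
arguments, since both derivatives have the Lie bracket as commutator, and skew in its last two,
since both satisfy the product rule for the metric. Only \<open>0\<close> has both symmetries.\<close>

lemma nabla_koszul:
  assumes X: "vector_field M X" and Y: "vector_field M Y" and w: "w \<in> tangent_space M p"
  shows "der (nabla X Y) x p \<bullet> vderiv w x = der X (der Y x) p \<bullet> vderiv w x"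
proof -
  have p: "p \<in> points M" using tangent_space_subset_points[OF w] .
  define D where "D X Y Z = der (nabla X Y) x p \<bullet> der Z x p - der X (der Y x) p \<bullet> der Z x p" for X Y Z
  have skew: "D X Y Z + D X Z Y = 0" if "vector_field M X" "vector_field M Y" "vector_field M Z" for X Y Z
    using nabla_metric[OF that p] by (simp add: D_def)
  have sym: "D X Y Z = D Y X Z" if "vector_field M X" "vector_field M Y" for X Y Z
  proof -
    have "der (nabla X Y) x p - der (nabla Y X) x p = der X (der Y x) p - der Y (der X x) p"
      using vderiv_lie_bracket[OF x_smooth_near[OF p], of X Y] torsion_free[OF that p]
      by (simp add: vderiv_vf_diff)
    then have "(der (nabla X Y) x p - der (nabla Y X) x p) \<bullet> der Z x p =
        (der X (der Y x) p - der Y (der X x) p) \<bullet> der Z x p" by simp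
    then show ?thesis by (simp add: D_def inner_diff_left)
  qed
  define Z where "Z = tangential (vderiv w x)"
  have Z: "vector_field M Z" "Z p = w"
    using tangential_vector_field tangential_dx[OF w] by (simp_all add: Z_def)
  \<comment> \<open>Alternating the two symmetries around the cycle of arguments gives \<open>D X Y Z = - D X Y Z\<close>.\<close>
  have "D X Y Z = 0"
    using skew[OF X Y Z(1)] skew[OF Y X Z(1)] skew[OF Z(1) X Y]
      sym[OF X Y, of Z] sym[OF Y Z(1), of X] sym[OF Z(1) X, of Y] by linarith
  then show ?thesis by (simp add: D_def Z(2))
qed

lemma nabla_tangential:
  assumes X: "vector_field M X" and Y: "vector_field M Y" and p: "p \<in> points M"
  shows "nabla X Y p = tangential (der X (der Y x) p) p"
  by (rule tangential_unique[symmetric, OF vector_field_tangent[OF nabla_vector_field[OF X Y] p]])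
    (simp add: inner_diff_left nabla_koszul[OF X Y])

lemma curvature_vector_field:
  assumes "vector_field M X" "vector_field M Y" "vector_field M Z"
  shows "vector_field M (curvature M nabla X Y Z)"
  unfolding curvature_def
  by (intro vector_field_diff nabla_vector_field lie_bracket_vector_field assms)

lemma hessian_symmetric:
  assumes X: "vector_field M X" and Y: "vector_field M Y" and f: "smooth_near M p f"
  shows "hessian nabla f p X Y = hessian nabla f p Y X"
proof -
  have "lie_bracket M X Y p f = nabla X Y p f - nabla Y X p f"
    using torsion_free[OF X Y smooth_near_points[OF f]] by (simp add: vf_diff_def)
  then show ?thesis using f by (simp add: lie_bracket_def hessian_def)
qed

text \<open>The value at \<open>p\<close> depends on the first field only through its value at \<open>p\<close>, and symmetry
transfers this to the second.\<close>

lemma hessian_pointwise: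
  assumes X: "vector_field M X" "vector_field M X'" "X p = X' p"
    and Y: "vector_field M Y" "vector_field M Y'" "Y p = Y' p" and f: "smooth_near M p f"
  shows "hessian nabla f p X Y = hessian nabla f p X' Y'"
proof -
  have left: "hessian nabla f p Z V = hessian nabla f p Z' V"
    if "vector_field M Z" "vector_field M Z'" "Z p = Z' p" "vector_field M V" for Z Z' V
    using that smooth_near_points[OF f] by (simp add: hessian_def nabla_tangential)
  have "hessian nabla f p X Y = hessian nabla f p X' Y" by (rule left[OF X Y(1)])
  also have "\<dots> = hessian nabla f p Y X'" by (rule hessian_symmetric[OF X(2) Y(1) f])
  also have "\<dots> = hessian nabla f p Y' X'" by (rule left[OF Y X(2)])
  also have "\<dots> = hessian nabla f p X' Y'" by (rule hessian_symmetric[OF Y(2) X(2) f])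
  finally show ?thesis .
qed

end

section \<open>The Gauss equation\<close>

locale hypersurface = levi_civita_immersion M g x nabla
  for M :: "('a, 'b::euclidean_space) manifold" and g
    and x :: "'a \<Rightarrow> 'e::euclidean_space" and nabla +
  fixes U :: "'a set" and N :: "'a \<Rightarrow> 'e"
  assumes codim: "DIM('e) = DIM('b) + 1"
    and normal: "unit_normal M x U N"
begin

lemma N_smooth: "smooth_fun_on M U N"
  using normal by (simp add: unit_normal_def)

lemma U_open: "openin (mtop M) U"
  by (rule smooth_fun_on_openin[OF N_smooth])

lemma U_points: "p \<in> U \<Longrightarrow> p \<in> points M"
  by (rule openin_points[OF U_open])

lemma N_near: "p \<in> U \<Longrightarrow> smooth_near M p N"
  by (rule smooth_nearI[OF N_smooth])

lemma N_unit: "p \<in> U \<Longrightarrow> N p \<bullet> N p = 1"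
  using normal by (simp add: unit_normal_def norm_eq_1)

lemma N_normal: "p \<in> U \<Longrightarrow> v \<in> tangent_space M p \<Longrightarrow> N p \<bullet> vderiv v x = 0"
  using normal by (simp add: unit_normal_def)

lemma vderiv_eq_on_U:
  assumes "p \<in> U" "v \<in> tangent_space M p" "\<And>q. q \<in> U \<Longrightarrow> F q = G q"
  shows "vderiv v F = vderiv v G"
  by (rule vderiv_cong[OF assms(2) U_open assms(1,3)])

lemma dN_normal:
  assumes p: "p \<in> U" and v: "v \<in> tangent_space M p"
  shows "vderiv v N \<bullet> N p = 0"
proof -
  have "vderiv v (\<lambda>q. N q \<bullet> N q) = vderiv v (\<lambda>q. 1)"
    by (rule vderiv_eq_on_U[OF p v N_unit])
  then show ?thesis
    using vderiv_inner[OF v N_near[OF p] N_near[OF p]] by (simp add: vderiv_const[OF v] inner_commute)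
qed

text \<open>Codimension one enters here: an orthonormal tangent frame together with \<open>N\<close> is a basis of the
ambient space.\<close>

lemma frame_expansion:
  assumes E: "orthonormal_at M g p E" and p: "p \<in> U"
  shows "i \<in> Basis \<Longrightarrow> E i p \<in> tangent_space M p"
    and "i \<in> Basis \<Longrightarrow> j \<in> Basis \<Longrightarrow> der (E i) x p \<bullet> der (E j) x p = (if i = j then 1 else 0)"
    and "i \<in> Basis \<Longrightarrow> der (E i) x p \<bullet> N p = 0"
    and "c = (\<Sum>i\<in>Basis. (c \<bullet> der (E i) x p) *\<^sub>R der (E i) x p) + (c \<bullet> N p) *\<^sub>R N p"
proof -
  show t: "i \<in> Basis \<Longrightarrow> E i p \<in> tangent_space M p" for i
    using E U_points[OF p] by (simp add: orthonormal_at_def vector_field_tangent)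
  show o: "i \<in> Basis \<Longrightarrow> j \<in> Basis \<Longrightarrow> der (E i) x p \<bullet> der (E j) x p = (if i = j then 1 else 0)" for i j
    using E g_eq[OF t t, of i j] by (simp add: orthonormal_at_def)
  show n: "i \<in> Basis \<Longrightarrow> der (E i) x p \<bullet> N p = 0" for i
    using N_normal[OF p t] by (simp add: inner_commute)
  show "c = (\<Sum>i\<in>Basis. (c \<bullet> der (E i) x p) *\<^sub>R der (E i) x p) + (c \<bullet> N p) *\<^sub>R N p"
    by (rule orthonormal_expansion[OF codim o N_unit[OF p] n])
qed

lemma dx_tangential:
  assumes p: "p \<in> U"
  shows "vderiv (tangential c p) x = c - (c \<bullet> N p) *\<^sub>R N p"
proof -
  obtain E where E: "orthonormal_at M g p E" using orthonormal_at_exists[OF U_points[OF p]] by blast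
  note F = frame_expansion[OF E p]
  note t = tangential[OF U_points[OF p]]
  define r where "r = c - vderiv (tangential c p) x"
  have "(\<Sum>i\<in>Basis. (r \<bullet> der (E i) x p) *\<^sub>R der (E i) x p) = 0"
    by (rule sum.neutral) (simp add: r_def t(2) F(1))
  moreover have "r \<bullet> N p = c \<bullet> N p"
    using N_normal[OF p t(1), of c] by (simp add: r_def inner_diff_left inner_diff_right inner_commute)
  ultimately have "r = (c \<bullet> N p) *\<^sub>R N p" using F(4)[of r] by simp
  then show ?thesis by (simp add: r_def algebra_simps)
qed

text \<open>Gauss formula. The normal component comes from differentiating \<open>N \<bullet> dx Y = 0\<close>.\<close>

lemma dx_nabla:
  assumes X: "vector_field M X" and Y: "vector_field M Y" and p: "p \<in> U"
  shows "der (nabla X Y) x p = der X (der Y x) p + (der X N p \<bullet> der Y x p) *\<^sub>R N p"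
proof -
  note Xt = vector_field_tangent[OF X U_points[OF p]]
  have "der X (\<lambda>q. N q \<bullet> der Y x q) p = der X (\<lambda>q. 0) p"
    by (rule vderiv_eq_on_U[OF p Xt]) (simp add: N_normal vector_field_tangent[OF Y U_points])
  then have "der X (der Y x) p \<bullet> N p = - (der X N p \<bullet> der Y x p)"
    using vderiv_inner[OF Xt N_near[OF p] smooth_nearI[OF x_der_smooth[OF Y] U_points[OF p]]]
    by (simp add: vderiv_const[OF Xt] inner_commute)
  then show ?thesis
    by (simp add: nabla_tangential[OF X Y U_points[OF p]] dx_tangential[OF p])
qed

text \<open>Symmetry of the second fundamental form: the normal components in the Gauss formula for \<open>\<nabla>\<^sub>X Y\<close>
and \<open>\<nabla>\<^sub>Y X\<close> agree because the Lie bracket is tangent.\<close>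

lemma dN_symmetric:
  assumes p: "p \<in> U" and u: "u \<in> tangent_space M p" and v: "v \<in> tangent_space M p"
  shows "vderiv u N \<bullet> vderiv v x = vderiv v N \<bullet> vderiv u x"
proof -
  define X where "X = tangential (vderiv u x)"
  define Y where "Y = tangential (vderiv v x)"
  have X: "vector_field M X" "X p = u" and Y: "vector_field M Y" "Y p = v"
    using tangential_vector_field tangential_dx[OF u] tangential_dx[OF v] by (simp_all add: X_def Y_def)
  have "der (nabla X Y) x p - der (nabla Y X) x p = der X (der Y x) p - der Y (der X x) p"
    using vderiv_lie_bracket[OF x_smooth_near[OF U_points[OF p]], of X Y] torsion_free[OF X(1) Y(1) U_points[OF p]]
    by (simp add: vderiv_vf_diff)
  then have "(der X N p \<bullet> der Y x p) *\<^sub>R N p = (der Y N p \<bullet> der X x p) *\<^sub>R N p"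
    by (simp add: dx_nabla[OF _ _ p] X Y algebra_simps)
  from arg_cong[where f = "\<lambda>c. c \<bullet> N p", OF this] show ?thesis by (simp add: N_unit[OF p] X Y)
qed

lemma dx_nabla_nabla:
  assumes X: "vector_field M X" and Y: "vector_field M Y" and Z: "vector_field M Z"
    and p: "p \<in> U" and w: "w \<in> tangent_space M p"
  shows "der (nabla Z (nabla X Y)) x p \<bullet> vderiv w x =
    der Z (der X (der Y x)) p \<bullet> vderiv w x + (der X N p \<bullet> der Y x p) * (der Z N p \<bullet> vderiv w x)"
proof -
  note Zt = vector_field_tangent[OF Z U_points[OF p]]
  note pp = U_points[OF p]
  have s1: "smooth_near M p (der X (der Y x))"
    by (intro vector_field_smooth_near X Y x_smooth_near pp)
  have s2: "smooth_near M p (\<lambda>q. der X N q \<bullet> der Y x q)"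
    by (intro smooth_near_inner vector_field_smooth_near X Y x_smooth_near pp N_near p)
  have s3: "smooth_near M p (\<lambda>q. (der X N q \<bullet> der Y x q) *\<^sub>R N q)"
    by (rule smooth_near_bilinear[OF bounded_bilinear_scaleR s2 N_near[OF p]])
  have "der Z (der (nabla X Y) x) p = der Z (\<lambda>q. der X (der Y x) q + (der X N q \<bullet> der Y x q) *\<^sub>R N q) p"
    by (rule vderiv_eq_on_U[OF p Zt]) (rule dx_nabla[OF X Y])
  also have "\<dots> = der Z (der X (der Y x)) p + ((der X N p \<bullet> der Y x p) *\<^sub>R der Z N p +
      der Z (\<lambda>q. der X N q \<bullet> der Y x q) p *\<^sub>R N p)"
    by (simp add: vderiv_add[OF Zt s1 s3] vderiv_scaleR[OF Zt s2 N_near[OF p]])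
  finally show ?thesis
    by (simp add: nabla_koszul[OF Z nabla_vector_field[OF X Y] w] inner_add_left N_normal[OF p w])
qed

text \<open>The third-order terms of \<open>\<nabla>\<^sub>Z \<nabla>\<^sub>X Y\<close>, \<open>\<nabla>\<^sub>X \<nabla>\<^sub>Z Y\<close> and \<open>\<nabla>\<^bsub>[Z,X]\<^esub> Y\<close> cancel by the definition of the bracket;
what remains are the two products that come from differentiating the normal components.\<close>

lemma gauss_equation:
  assumes X: "vector_field M X" and Y: "vector_field M Y" and Z: "vector_field M Z"
    and p: "p \<in> U" and w: "w \<in> tangent_space M p"
  shows "der (curvature M nabla Z X Y) x p \<bullet> vderiv w x =
    (der X N p \<bullet> der Y x p) * (der Z N p \<bullet> vderiv w x) - (der Z N p \<bullet> der Y x p) * (der X N p \<bullet> vderiv w x)"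
proof -
  have "der (nabla (lie_bracket M Z X) Y) x p \<bullet> vderiv w x =
      (der Z (der X (der Y x)) p - der X (der Z (der Y x)) p) \<bullet> vderiv w x"
    using nabla_koszul[OF lie_bracket_vector_field[OF Z X] Y w]
      vderiv_lie_bracket[OF smooth_nearI[OF x_der_smooth[OF Y] U_points[OF p]], of Z X] by simp
  then show ?thesis
    by (simp add: curvature_def vderiv_vf_diff inner_diff_left
        dx_nabla_nabla[OF X Y Z p w] dx_nabla_nabla[OF Z Y X p w])
qed

section \<open>Recurrent Jacobi operators vanish\<close>

lemma jacobi_gauss:
  assumes "vector_field M X" "vector_field M Z" "p \<in> U" "w \<in> tangent_space M p"
  shows "der (jacobi_operator M nabla X Z) x p \<bullet> vderiv w x =
    (der X N p \<bullet> der X x p) * (der Z N p \<bullet> vderiv w x) - (der Z N p \<bullet> der X x p) * (der X N p \<bullet> vderiv w x)"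
  unfolding jacobi_operator_def by (rule gauss_equation[OF assms(1,1,2-4)])

lemma jacobi_vector_field:
  "vector_field M X \<Longrightarrow> vector_field M Z \<Longrightarrow> vector_field M (jacobi_operator M nabla X Z)"
  unfolding jacobi_operator_def by (rule curvature_vector_field)

lemma jacobi_scale:
  assumes f: "smooth_fun_on M (points M) f" and X: "vector_field M X" and Z: "vector_field M Z"
    and q: "q \<in> U"
  shows "der (jacobi_operator M nabla (vf_scale f X) Z) x q = (f q * f q) *\<^sub>R der (jacobi_operator M nabla X Z) x q"
proof -
  note fX = vector_field_scale[OF f X]
  note J = vector_field_tangent[OF jacobi_vector_field U_points[OF q]]
  have "jacobi_operator M nabla (vf_scale f X) Z q =
      tlincomb (f q * f q) (jacobi_operator M nabla X Z q) 0 (jacobi_operator M nabla X Z q)"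
  proof (rule tangent_eqI)
    fix w assume w: "w \<in> tangent_space M q"
    show "der (jacobi_operator M nabla (vf_scale f X) Z) x q \<bullet> vderiv w x =
        vderiv (tlincomb (f q * f q) (jacobi_operator M nabla X Z q) 0 (jacobi_operator M nabla X Z q)) x
          \<bullet> vderiv w x"
      by (simp add: vderiv_tlincomb jacobi_gauss[OF fX Z q w] jacobi_gauss[OF X Z q w] vderiv_vf_scale
          algebra_simps)
  qed (intro tangent_space_tlincomb J fX X Z)+
  then show ?thesis by (simp add: vderiv_tlincomb)
qed

text \<open>The recurrence conditions for \<open>X\<close> and \<open>f X\<close>, both in the direction \<open>X\<close>, are compared at \<open>p\<close>. The function
\<open>f = 1 + (x - x p) \<bullet> c\<close> with \<open>c = dx (X p)\<close> has \<open>f p = 1\<close> and, because \<open>X p\<close> is a unit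
vector, derivative \<open>1\<close> in the direction \<open>X p\<close>. The terms with the form \<open>\<eta>\<close> agree, and the
derivative of \<open>f\<^sup>2\<close> contributes twice the Jacobi operator.\<close>

lemma recurrent_imp_jacobi_zero:
  assumes rec: "recurrent_jacobi_operators M nabla"
    and X: "vector_field M X" and Z: "vector_field M Z" and p: "p \<in> U"
    and unit: "der X x p \<bullet> der X x p = 1" and w: "w \<in> tangent_space M p"
  shows "der (jacobi_operator M nabla X Z) x p \<bullet> vderiv w x = 0"
proof -
  obtain \<eta> where \<eta>: "\<And>X Y Z. vector_field M X \<Longrightarrow> vector_field M Y \<Longrightarrow> vector_field M Z \<Longrightarrow>
      vf_eq M (cov_deriv_tensor nabla Y (jacobi_operator M nabla X) Z)
        (vf_scale (\<lambda>p. \<eta> p (Y p)) (jacobi_operator M nabla X Z))"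
    using rec unfolding recurrent_jacobi_operators_def by blast
  let ?J = "\<lambda>X Z. jacobi_operator M nabla X Z"
  note pp = U_points[OF p] and Xt = vector_field_tangent[OF X U_points[OF p]]
  have rec_at: "der (nabla X (?J V Z)) x p - der (?J V (nabla X Z)) x p = \<eta> p (X p) *\<^sub>R der (?J V Z) x p"
    if V: "vector_field M V" for V
  proof -
    have "cov_deriv_tensor nabla X (?J V) Z p = vf_scale (\<lambda>p. \<eta> p (X p)) (?J V Z) p"
      using \<eta>[OF V X Z] pp by (simp add: vf_eq_def)
    then have "vderiv (cov_deriv_tensor nabla X (?J V) Z p) x = vderiv (vf_scale (\<lambda>p. \<eta> p (X p)) (?J V Z) p) x"
      by simp
    then show ?thesis by (simp add: cov_deriv_tensor_def vderiv_vf_diff vderiv_vf_scale)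
  qed
  define c where "c = der X x p"
  define f where "f q = x q \<bullet> c + (1 - x p \<bullet> c)" for q
  have f_smooth: "smooth_fun_on M (points M) f"
    unfolding f_def by (intro smooth_fun_on_add smooth_fun_on_inner_const x_smooth smooth_fun_on_const openin_points_self)
  note f_near = smooth_nearI[OF f_smooth pp]
  have fp: "f p = 1" by (simp add: f_def)
  have df: "vderiv (X p) f = 1"
    unfolding f_def
    using vderiv_add[OF Xt smooth_near_inner_const[OF x_smooth_near[OF pp]] smooth_near_const[OF pp]]
      vderiv_linear[OF bounded_linear_inner_left Xt x_smooth_near[OF pp]]
    by (simp add: vderiv_const[OF Xt] c_def unit)
  note fX = vector_field_scale[OF f_smooth X]
  note J = jacobi_vector_field[OF X Z] and J' = jacobi_vector_field[OF fX Z]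
  have ff: "smooth_near M p (\<lambda>q. f q * f q)"
    by (rule smooth_near_bilinear[OF bounded_bilinear_mult f_near f_near])
  have "der X (der (?J (vf_scale f X) Z) x) p = der X (\<lambda>q. (f q * f q) *\<^sub>R der (?J X Z) x q) p"
    by (rule vderiv_eq_on_U[OF p Xt jacobi_scale[OF f_smooth X Z]])
  also have "\<dots> = der X (der (?J X Z) x) p + 2 *\<^sub>R der (?J X Z) x p"
    using vderiv_scaleR[OF Xt ff smooth_nearI[OF x_der_smooth[OF J] pp]]
      vderiv_bilinear[OF bounded_bilinear_mult Xt f_near f_near] by (simp add: fp df)
  finally have 1: "der (nabla X (?J (vf_scale f X) Z)) x p \<bullet> vderiv w x =
      der (nabla X (?J X Z)) x p \<bullet> vderiv w x + 2 * (der (?J X Z) x p \<bullet> vderiv w x)"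
    by (simp add: nabla_koszul[OF X J' w] nabla_koszul[OF X J w] inner_add_left)
  have "der (?J (vf_scale f X) Z) x p = der (?J X Z) x p"
    "der (?J (vf_scale f X) (nabla X Z)) x p = der (?J X (nabla X Z)) x p"
    using jacobi_scale[OF f_smooth X Z p] jacobi_scale[OF f_smooth X nabla_vector_field[OF X Z] p]
    by (simp_all add: fp)
  then have "der (nabla X (?J (vf_scale f X) Z)) x p = der (nabla X (?J X Z)) x p"
    using rec_at[OF X] rec_at[OF fX] by (simp add: diff_eq_eq)
  with 1 show ?thesis by simp
qed

lemma second_fundamental_form_degenerate:
  assumes rec: "recurrent_jacobi_operators M nabla" and p: "p \<in> U"
    and u: "u \<in> tangent_space M p" and v: "v \<in> tangent_space M p" and w: "w \<in> tangent_space M p"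
    and unit: "vderiv u x \<bullet> vderiv u x = 1"
  shows "(vderiv u N \<bullet> vderiv u x) * (vderiv v N \<bullet> vderiv w x) =
    (vderiv v N \<bullet> vderiv u x) * (vderiv u N \<bullet> vderiv w x)"
proof -
  define X where "X = tangential (vderiv u x)"
  define Z where "Z = tangential (vderiv v x)"
  have X: "vector_field M X" "X p = u" and Z: "vector_field M Z" "Z p = v"
    using tangential_vector_field tangential_dx[OF u] tangential_dx[OF v] by (simp_all add: X_def Z_def)
  show ?thesis
    using recurrent_imp_jacobi_zero[OF rec X(1) Z(1) p _ w] jacobi_gauss[OF X(1) Z(1) p w] unit
    by (simp add: X Z)
qed

section \<open>Mean curvature and the trace of the Codazzi equation\<close>

abbreviation H :: "'a \<Rightarrow> real" where "H \<equiv> mean_curvature M g x N"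

lemma tangential_normal_zero:
  assumes p: "p \<in> U" shows "tangential (r *\<^sub>R N p) p = (\<lambda>f. 0)"
  by (rule tangential_unique[OF tangent_space_zero[OF U_points[OF p]]])
    (simp add: vderiv_zero N_normal[OF p])

lemma dN_inner_tangential:
  assumes p: "p \<in> U" and v: "v \<in> tangent_space M p"
  shows "vderiv v N \<bullet> vderiv (tangential c p) x = vderiv v N \<bullet> c"
  by (simp add: dx_tangential[OF p] inner_diff_right dN_normal[OF p v])

lemma shape_operator:
  assumes p: "p \<in> U" and v: "v \<in> tangent_space M p"
  shows "shape_operator M x N p v \<in> tangent_space M p"
    and "vderiv (shape_operator M x N p v) x = - vderiv v N"
proof -
  let ?w = "tangential (- vderiv v N) p"
  have w: "?w \<in> tangent_space M p" "vderiv ?w x = - vderiv v N"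
    using tangential(1)[OF U_points[OF p]] dN_normal[OF p v] by (simp_all add: dx_tangential[OF p])
  have "shape_operator M x N p v = ?w"
    unfolding shape_operator_def
    by (rule the_equality) (use w in \<open>auto intro!: tangent_eqI_dx\<close>)
  with w show "shape_operator M x N p v \<in> tangent_space M p"
    "vderiv (shape_operator M x N p v) x = - vderiv v N" by simp_all
qed

lemma vderiv_tangential_linear:
  "p \<in> points M \<Longrightarrow> linear (\<lambda>c. vderiv (tangential c p) F)"
  using tangential_linear[of p 1 _ 1] tangential_linear[of p _ _ 0 0]
  by (intro linearI) (simp_all add: vderiv_tlincomb)

text \<open>The normal direction contributes nothing to the trace, so it may be added and the orthonormal basis
then be replaced by the constant one. In this form the mean curvature is visibly smooth.\<close>

lemma mean_curvature_trace_Basis: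
  assumes p: "p \<in> U"
  shows "real DIM('b) * H p = - (\<Sum>c\<in>Basis. vderiv (tangential c p) N \<bullet> c)"
proof -
  obtain E where E: "orthonormal_at M g p E"
    and tr: "\<And>B. metric_trace M g p B = (\<Sum>i\<in>Basis. B (E i) (E i))"
    using metric_trace_frame[OF U_points[OF p]] by blast
  note F = frame_expansion[OF E p]
  have "real DIM('b) * H p = (\<Sum>i\<in>Basis. g p (shape_operator M x N p (E i p)) (E i p))"
    by (simp add: mean_curvature_def tr)
  also have "\<dots> = (\<Sum>i\<in>Basis. - (der (E i) N p \<bullet> der (E i) x p))"
    by (rule sum.cong) (simp_all add: g_eq shape_operator[OF p F(1)] F(1))
  also have "\<dots> = - (\<Sum>i\<in>Basis. vderiv (tangential (der (E i) x p) p) N \<bullet> der (E i) x p)"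
    unfolding sum_negf by (simp add: tangential_dx F(1))
  also have "\<dots> = - ((\<Sum>i\<in>Basis. vderiv (tangential (der (E i) x p) p) N \<bullet> der (E i) x p) +
      vderiv (tangential (N p) p) N \<bullet> N p)"
    by (simp add: dN_normal[OF p tangential(1)[OF U_points[OF p]]])
  also have "\<dots> = - (\<Sum>c\<in>Basis. vderiv (tangential c p) N \<bullet> c)"
    using trace_orthonormal[OF codim F(2) N_unit[OF p] F(3) vderiv_tangential_linear[OF U_points[OF p]]]
    by simp
  finally show ?thesis .
qed

lemma der_tangential_smooth: "smooth_fun_on M W F \<Longrightarrow> smooth_fun_on M W (der (tangential c) F)"
  by (rule vector_field_smooth[OF tangential_vector_field])

lemma mean_curvature_smooth: "smooth_fun_on M U H"
proof (rule smooth_fun_on_cong)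
  show "smooth_fun_on M U (\<lambda>q. (- 1 / real DIM('b)) * (\<Sum>c\<in>Basis. der (tangential c) N q \<bullet> c))"
    by (intro smooth_fun_on_linear[OF bounded_linear_mult_right] smooth_fun_on_sum U_open
        smooth_fun_on_inner_const der_tangential_smooth N_smooth)
  show "(- 1 / real DIM('b)) * (\<Sum>c\<in>Basis. der (tangential c) N q \<bullet> c) = H q" if "q \<in> U" for q
    using mean_curvature_trace_Basis[OF that] by (simp add: field_simps)
qed

lemma mean_curvature_vector_smooth_near:
  "p \<in> U \<Longrightarrow> smooth_near M p (mean_curvature_vector M g x N)"
  unfolding mean_curvature_vector_def[abs_def]
  by (rule smooth_near_bilinear[OF bounded_bilinear_scaleR smooth_nearI[OF mean_curvature_smooth] N_near])

text \<open>The tangential part of \<open>c\<close> is \<open>c - (c \<bullet> N) N\<close>. Where \<open>c \<bullet> N = 0\<close>, the derivative of this is a multiple of \<open>N\<close>, whose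
tangential part is \<open>0\<close>.\<close>

lemma nabla_tangential_zero:
  assumes X: "vector_field M X" and p: "p \<in> U" and c: "c \<bullet> N p = 0"
  shows "nabla X (tangential c) p = (\<lambda>f. 0)"
proof -
  note pp = U_points[OF p] and Xt = vector_field_tangent[OF X U_points[OF p]]
  have cN: "smooth_near M p (\<lambda>q. c \<bullet> N q)"
    by (rule smooth_near_linear[OF bounded_linear_inner_right N_near[OF p]])
  have "der X (der (tangential c) x) p = der X (\<lambda>q. c + - ((c \<bullet> N q) *\<^sub>R N q)) p"
    by (rule vderiv_eq_on_U[OF p Xt]) (simp add: dx_tangential)
  also have "\<dots> = - der X (\<lambda>q. (c \<bullet> N q) *\<^sub>R N q) p"
    using vderiv_add[OF Xt smooth_near_const[OF pp]
        smooth_near_linear[OF bounded_linear_minus[OF bounded_linear_ident]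
          smooth_near_bilinear[OF bounded_bilinear_scaleR cN N_near[OF p]]]]
      vderiv_linear[OF bounded_linear_minus[OF bounded_linear_ident] Xt
        smooth_near_bilinear[OF bounded_bilinear_scaleR cN N_near[OF p]]]
    by (simp add: vderiv_const[OF Xt])
  also have "\<dots> = (- der X (\<lambda>q. c \<bullet> N q) p) *\<^sub>R N p"
    by (simp add: vderiv_scaleR[OF Xt cN N_near[OF p]] c)
  finally show ?thesis
    by (simp only: nabla_tangential[OF X tangential_vector_field pp] tangential_normal_zero[OF p])
qed

text \<open>The frame \<open>E\<close> in the trace is replaced by the tangential parts of the constant vectors
\<open>dx (E i p)\<close>, which agree with \<open>E\<close> at \<open>p\<close> and have no connection terms there.\<close>

lemma vlaplacian_frame:
  assumes p: "p \<in> U"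
  shows "\<exists>a :: 'b \<Rightarrow> 'e. (\<forall>i\<in>Basis. \<forall>j\<in>Basis. a i \<bullet> a j = (if i = j then 1 else 0)) \<and>
    (\<forall>i\<in>Basis. a i \<bullet> N p = 0) \<and>
    (\<forall>F :: 'a \<Rightarrow> 'e. smooth_near M p F \<longrightarrow>
      vlaplacian M g nabla F p = - (\<Sum>i\<in>Basis. der (tangential (a i)) (der (tangential (a i)) F) p))"
proof -
  obtain E where E: "orthonormal_at M g p E"
    and tr: "\<And>B. metric_trace M g p B = (\<Sum>i\<in>Basis. B (E i) (E i))"
    using metric_trace_frame[OF U_points[OF p]] by blast
  note Fr = frame_expansion[OF E p]
  define a where "a i = der (E i) x p" for i
  have ap: "tangential (a i) p = E i p" if "i \<in> Basis" for i
    using tangential_dx[OF Fr(1)[OF that]] by (simp add: a_def)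
  have an: "a i \<bullet> N p = 0" if "i \<in> Basis" for i
    using Fr(3)[OF that] by (simp add: a_def)
  have lap: "laplacian M g nabla f p = - (\<Sum>i\<in>Basis. tangential (a i) p (\<lambda>q. tangential (a i) q f))"
    if f: "smooth_near M p f" for f
  proof -
    have "hessian nabla f p (E i) (E i) = tangential (a i) p (\<lambda>q. tangential (a i) q f)"
      if i: "i \<in> Basis" for i
    proof -
      have "vector_field M (E i)" using E i by (simp add: orthonormal_at_def)
      then have "hessian nabla f p (E i) (E i) = hessian nabla f p (tangential (a i)) (tangential (a i))"
        by (intro hessian_pointwise tangential_vector_field f) (simp_all add: ap[OF i])
      then show ?thesis
        by (simp add: hessian_def nabla_tangential_zero[OF tangential_vector_field p an[OF i]])
    qed
    then show ?thesis by (simp add: laplacian_def tr)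
  qed
  have vlap: "vlaplacian M g nabla F p = - (\<Sum>i\<in>Basis. der (tangential (a i)) (der (tangential (a i)) F) p)"
    if F: "smooth_near M p F" for F :: "'a \<Rightarrow> 'e"
  proof (rule euclidean_eqI)
    fix c :: 'e assume c: "c \<in> Basis"
    have "vlaplacian M g nabla F p \<bullet> c = laplacian M g nabla (\<lambda>q. F q \<bullet> c) p"
      using c by (simp add: vlaplacian_def)
    then show "vlaplacian M g nabla F p \<bullet> c =
        - (\<Sum>i\<in>Basis. der (tangential (a i)) (der (tangential (a i)) F) p) \<bullet> c"
      by (simp add: inner_sum_left vderiv_inner_Basis[OF c] lap[OF smooth_near_inner_const[OF F]])
  qed
  show ?thesis
    by (rule exI[of _ a], intro conjI ballI allI impI) (simp_all add: an vlap, simp_all add: a_def Fr(2))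
qed

text \<open>The mean curvature is written with the constant orthonormal basis consisting of the \<open>a i\<close> and
\<open>\<nu> = N p\<close>. The summand of \<open>\<nu>\<close> is a product of two functions that vanish at \<open>p\<close> and has
derivative \<open>0\<close>. In the other summands the two derivatives commute at \<open>p\<close>, and then symmetry of the
second fundamental form exchanges \<open>a i\<close> and \<open>b\<close>.\<close>

lemma codazzi_trace:
  assumes p: "p \<in> U"
    and a: "\<And>i j. i \<in> Basis \<Longrightarrow> j \<in> Basis \<Longrightarrow> a i \<bullet> a j = (if i = j then 1 else 0)"
    and an: "\<And>i. i \<in> Basis \<Longrightarrow> a (i::'b) \<bullet> N p = 0" and b: "b \<bullet> N p = 0"
  shows "real DIM('b) * vderiv (tangential b p) H =
    - (\<Sum>i\<in>Basis. der (tangential (a i)) (der (tangential (a i)) N) p \<bullet> b)"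
proof -
  define \<nu> where "\<nu> = N p"
  define v where "v = tangential b p"
  note pp = U_points[OF p]
  note near = smooth_nearI[OF der_tangential_smooth[OF N_smooth] p]
  have v: "v \<in> tangent_space M p" unfolding v_def by (rule tangential(1)[OF pp])
  note t = tangential(1)[OF U_points]
  have H: "real DIM('b) * H q = - ((\<Sum>i\<in>Basis. der (tangential (a i)) N q \<bullet> a i) + der (tangential \<nu>) N q \<bullet> \<nu>)"
    if q: "q \<in> U" for q
    using mean_curvature_trace_Basis[OF q] N_unit[OF p] an
      trace_orthonormal[OF codim a _ _ vderiv_tangential_linear[OF U_points[OF q]], of \<nu> N]
    by (simp add: \<nu>_def)
  have sn: "smooth_near M p (\<lambda>q. der (tangential c) N q \<bullet> d)" for c d
    by (rule smooth_near_inner_const[OF near])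
  have "real DIM('b) * vderiv v H = vderiv v (\<lambda>q. real DIM('b) * H q)"
    by (rule vderiv_linear[OF bounded_linear_mult_right v smooth_nearI[OF mean_curvature_smooth p], symmetric])
  also have "\<dots> = vderiv v (\<lambda>q. - ((\<Sum>i\<in>Basis. der (tangential (a i)) N q \<bullet> a i) + der (tangential \<nu>) N q \<bullet> \<nu>))"
    by (rule vderiv_eq_on_U[OF p v H])
  also have "\<dots> = - ((\<Sum>i\<in>Basis. vderiv v (\<lambda>q. der (tangential (a i)) N q \<bullet> a i)) +
      vderiv v (\<lambda>q. der (tangential \<nu>) N q \<bullet> \<nu>))"
  proof -
    have s: "smooth_near M p (\<lambda>q. \<Sum>i\<in>Basis. der (tangential (a i)) N q \<bullet> a i)"
      by (rule smooth_nearI[OF smooth_fun_on_sum[OF U_open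
              smooth_fun_on_inner_const[OF der_tangential_smooth[OF N_smooth]]] p])
    show ?thesis
      using vderiv_linear[OF bounded_linear_minus[OF bounded_linear_ident] v smooth_near_add[OF s sn[of \<nu> \<nu>]]]
        vderiv_add[OF v s sn[of \<nu> \<nu>]] conjunct1[OF vderiv_sum[OF v, of Basis "\<lambda>i q. der (tangential (a i)) N q \<bullet> a i", OF sn]]
      by simp
  qed
  also have "vderiv v (\<lambda>q. der (tangential \<nu>) N q \<bullet> \<nu>) = 0"
  proof -
    have "vderiv v (\<lambda>q. der (tangential \<nu>) N q \<bullet> \<nu>) =
        vderiv v (\<lambda>q. der (tangential \<nu>) N q \<bullet> der (tangential \<nu>) x q)"
      by (rule vderiv_eq_on_U[OF p v]) (simp add: dN_inner_tangential t)
    also have "\<dots> = 0"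
    proof -
      have "tangential \<nu> p = (\<lambda>f. 0)" using tangential_normal_zero[OF p, of 1] by (simp add: \<nu>_def)
      \<comment> \<open>Both factors \<open>dN V\<close> and \<open>dx V\<close> vanish at \<open>p\<close>, for \<open>V\<close> the tangential part of \<open>\<nu>\<close>.\<close>
      then show ?thesis
        using vderiv_inner[OF v near smooth_nearI[OF der_tangential_smooth[OF x_smooth] pp], of \<nu> \<nu>]
        by (simp add: vderiv_zero)
    qed
    finally show ?thesis .
  qed
  also have "(\<Sum>i\<in>Basis. vderiv v (\<lambda>q. der (tangential (a i)) N q \<bullet> a i)) =
      (\<Sum>i\<in>Basis. der (tangential (a i)) (der (tangential (a i)) N) p \<bullet> b)"
  proof (rule sum.cong[OF refl])
    fix i :: 'b assume i: "i \<in> Basis"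
    let ?e = "tangential (a i)"
    have "lie_bracket M (tangential b) ?e p = (\<lambda>f. 0)"
      using nabla_tangential_zero[OF tangential_vector_field[of b] p an[OF i]]
        nabla_tangential_zero[OF tangential_vector_field[of "a i"] p b]
      by (simp add: torsion_free[OF tangential_vector_field tangential_vector_field pp] vf_diff_def)
    then have comm: "der (tangential b) (der ?e N) p = der ?e (der (tangential b) N) p"
      using vderiv_lie_bracket[OF N_near[OF p], of "tangential b" ?e] by (simp add: vderiv_zero)
    have "vderiv v (\<lambda>q. der ?e N q \<bullet> a i) = der ?e (der (tangential b) N) p \<bullet> a i"
      using vderiv_linear[OF bounded_linear_inner_left v near] comm by (simp add: v_def)
    also have "\<dots> = der ?e (\<lambda>q. der (tangential b) N q \<bullet> a i) p"
      by (rule vderiv_linear[OF bounded_linear_inner_left t[OF p] near, symmetric])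
    also have "\<dots> = der ?e (\<lambda>q. der ?e N q \<bullet> b) p"
    proof (rule vderiv_eq_on_U[OF p t[OF p]])
      fix q assume q: "q \<in> U"
      show "der (tangential b) N q \<bullet> a i = der ?e N q \<bullet> b"
        using dN_inner_tangential[OF q t[OF q], of b "a i"] dN_inner_tangential[OF q t[OF q], of "a i" b]
          dN_symmetric[OF q t[OF q] t[OF q], of b "a i"] by simp
    qed
    also have "\<dots> = der ?e (der ?e N) p \<bullet> b"
      by (rule vderiv_linear[OF bounded_linear_inner_left t[OF p] near])
    finally show "vderiv v (\<lambda>q. der ?e N q \<bullet> a i) = der ?e (der ?e N) p \<bullet> b" .
  qed
  finally show ?thesis by (simp add: v_def)
qed

lemma mean_curvature_trace_frame:
  assumes p: "p \<in> U"
    and a: "\<And>i j. i \<in> Basis \<Longrightarrow> j \<in> Basis \<Longrightarrow> a i \<bullet> a j = (if i = j then 1 else 0)"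
    and an: "\<And>i. i \<in> Basis \<Longrightarrow> a (i::'b) \<bullet> N p = 0"
  shows "real DIM('b) * H p = - (\<Sum>i\<in>Basis. vderiv (tangential (a i) p) N \<bullet> a i)"
  using trace_orthonormal[OF codim a N_unit[OF p] an vderiv_tangential_linear[OF U_points[OF p]], of N]
    mean_curvature_trace_Basis[OF p] dN_normal[OF p tangential(1)[OF U_points[OF p]]] by simp

section \<open>The biharmonic equation\<close>

lemma second_derivative_mean_curvature_vector:
  assumes p: "p \<in> U"
  shows "der (tangential c) (der (tangential c) (mean_curvature_vector M g x N)) p =
    der (tangential c) (der (tangential c) H) p *\<^sub>R N p + (2 * der (tangential c) H p) *\<^sub>R der (tangential c) N p
      + H p *\<^sub>R der (tangential c) (der (tangential c) N) p"
proof -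
  let ?e = "tangential c"
  have t: "?e q \<in> tangent_space M q" if "q \<in> U" for q using tangential(1)[OF U_points[OF that]] .
  note Hn = smooth_nearI[OF mean_curvature_smooth] and eHn = smooth_nearI[OF der_tangential_smooth[OF mean_curvature_smooth]]
    and eNn = smooth_nearI[OF der_tangential_smooth[OF N_smooth]]
  have "der ?e (der ?e (mean_curvature_vector M g x N)) p =
      der ?e (\<lambda>q. H q *\<^sub>R der ?e N q + der ?e H q *\<^sub>R N q) p"
  proof (rule vderiv_eq_on_U[OF p t[OF p]])
    fix q assume q: "q \<in> U"
    show "der ?e (mean_curvature_vector M g x N) q = H q *\<^sub>R der ?e N q + der ?e H q *\<^sub>R N q"
      using vderiv_scaleR[OF t[OF q] Hn[OF q] N_near[OF q]] 
      unfolding mean_curvature_vector_def[abs_def] .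
  qed
  also have "\<dots> = der ?e (\<lambda>q. H q *\<^sub>R der ?e N q) p + der ?e (\<lambda>q. der ?e H q *\<^sub>R N q) p"
    by (rule vderiv_add[OF t[OF p] smooth_near_bilinear[OF bounded_bilinear_scaleR Hn[OF p] eNn[OF p]]
          smooth_near_bilinear[OF bounded_bilinear_scaleR eHn[OF p] N_near[OF p]]])
  also have "der ?e (\<lambda>q. H q *\<^sub>R der ?e N q) p = H p *\<^sub>R der ?e (der ?e N) p + der ?e H p *\<^sub>R der ?e N p"
    by (rule vderiv_scaleR[OF t[OF p] Hn[OF p] eNn[OF p]])
  also have "der ?e (\<lambda>q. der ?e H q *\<^sub>R N q) p = der ?e H p *\<^sub>R der ?e N p + der ?e (der ?e H) p *\<^sub>R N p"
    by (rule vderiv_scaleR[OF t[OF p] eHn[OF p] N_near[OF p]])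
  finally show ?thesis by (simp only: mult_2 scaleR_add_left add_ac)
qed

text \<open>Where \<open>H \<noteq> 0\<close>, the biharmonic equation is paired with a tangent vector \<open>a j\<close>. The Codazzi
trace turns its last term into \<open>- n H (\<xi> j)\<close>, and the degenerate second fundamental form \<open>h\<close> meets
the hypotheses of \<open>rank_one_gradient_zero\<close>. The sign of \<open>h\<close> is that of \<open>dN\<close>, so its trace is \<open>- n H\<close>.\<close>

lemma mean_curvature_gradient:
  assumes rec: "recurrent_jacobi_operators M nabla"
    and bih: "\<And>p. p \<in> U \<Longrightarrow> vlaplacian M g nabla (mean_curvature_vector M g x N) p = 0"
    and p: "p \<in> U" and v: "v \<in> tangent_space M p"
  shows "H p * vderiv v H = 0"
proof (cases "H p = 0")
  case False
  note t = tangential(1)[OF U_points[OF p]]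
  obtain a :: "'b \<Rightarrow> 'e" where
    "(\<forall>i\<in>Basis. \<forall>j\<in>Basis. a i \<bullet> a j = (if i = j then 1 else 0)) \<and>
     (\<forall>i\<in>Basis. a i \<bullet> N p = 0) \<and>
     (\<forall>F :: 'a \<Rightarrow> 'e. smooth_near M p F \<longrightarrow>
      vlaplacian M g nabla F p = - (\<Sum>i\<in>Basis. der (tangential (a i)) (der (tangential (a i)) F) p))"
    using vlaplacian_frame[OF p] by (rule exE)
  then have a: "\<And>i j. i \<in> Basis \<Longrightarrow> j \<in> Basis \<Longrightarrow> a i \<bullet> a j = (if i = j then 1 else 0)"
    and an: "\<And>i. i \<in> Basis \<Longrightarrow> a i \<bullet> N p = 0"
    and lap: "\<And>F :: 'a \<Rightarrow> 'e. smooth_near M p F \<Longrightarrow>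
      vlaplacian M g nabla F p = - (\<Sum>i\<in>Basis. der (tangential (a i)) (der (tangential (a i)) F) p)"
    by blast+
  define h where "h i j = der (tangential (a i)) N p \<bullet> a j" for i j
  define \<xi> where "\<xi> i = der (tangential (a i)) H p" for i
  have dx: "der (tangential (a i)) x p = a i" if "i \<in> Basis" for i
    by (simp add: dx_tangential[OF p] an[OF that])
  have tr: "real DIM('b) * H p = - (\<Sum>i\<in>Basis. h i i)"
    using mean_curvature_trace_frame[OF p a an] by (simp add: h_def)
  have \<xi>: "\<xi> j = 0" if j: "j \<in> Basis" for j
  proof (rule rank_one_gradient_zero[OF finite_Basis _ _ _ j, where h = h])
    show "(\<Sum>i\<in>Basis. h i i) \<noteq> 0" using tr False by auto
    show "h k k * h i j = h i k * h k j" if "i \<in> Basis" "j \<in> Basis" "k \<in> Basis" for i j k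
      using second_fundamental_form_degenerate[OF rec p t t t, of "a k" "a i" "a j"] that
      by (simp add: h_def dx a)
    show "2 * (\<Sum>i\<in>Basis. \<xi> i * h i j) = - (\<Sum>i\<in>Basis. h i i) * \<xi> j" if j: "j \<in> Basis" for j
    proof -
      have "0 = (\<Sum>i\<in>Basis. der (tangential (a i)) (der (tangential (a i)) (mean_curvature_vector M g x N)) p) \<bullet> a j"
        using bih[OF p] lap[OF mean_curvature_vector_smooth_near[OF p]] by simp
      also have "\<dots> = 2 * (\<Sum>i\<in>Basis. \<xi> i * h i j) +
          H p * (\<Sum>i\<in>Basis. der (tangential (a i)) (der (tangential (a i)) N) p \<bullet> a j)"
        using an[OF j]
        by (simp add: second_derivative_mean_curvature_vector[OF p] inner_sum_left inner_add_left sum.distrib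
            sum_distrib_left \<xi>_def h_def inner_commute[of "N p"] mult.assoc)
      also have "(\<Sum>i\<in>Basis. der (tangential (a i)) (der (tangential (a i)) N) p \<bullet> a j) = - real DIM('b) * \<xi> j"
        using codazzi_trace[OF p a an an[OF j]] by (simp add: \<xi>_def)
      finally show ?thesis using tr by (simp add: algebra_simps)
    qed
  qed
  have "vderiv v H = vderiv (tangential (\<Sum>i\<in>Basis. (vderiv v x \<bullet> a i) *\<^sub>R a i) p) H"
    using orthonormal_expansion[OF codim a N_unit[OF p] an, of "vderiv v x"] N_normal[OF p v] tangential_dx[OF v]
    by (simp add: inner_commute)
  also have "\<dots> = (\<Sum>i\<in>Basis. (vderiv v x \<bullet> a i) * \<xi> i)"
    using linear_sum[OF vderiv_tangential_linear[OF U_points[OF p], of H], of "\<lambda>i. (vderiv v x \<bullet> a i) *\<^sub>R a i" Basis]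
      linear_cmul[OF vderiv_tangential_linear[OF U_points[OF p], of H]]
    by (simp add: \<xi>_def)
  finally show ?thesis using \<xi> by simp
qed simp

text \<open>The equation \<open>H dH = 0\<close> holds on all of \<open>U\<close> and may be differentiated; at a point with \<open>H \<noteq> 0\<close> this
gives vanishing second derivatives of \<open>H\<close>. The normal part of the biharmonic equation then says that
\<open>H\<close> times the sum of the \<open>\<bar>dN (a i)\<bar>\<^sup>2\<close> is \<open>0\<close>, by differentiating \<open>dN \<bullet> N = 0\<close>.\<close>

lemma mean_curvature_zero:
  assumes rec: "recurrent_jacobi_operators M nabla"
    and bih: "\<And>p. p \<in> U \<Longrightarrow> vlaplacian M g nabla (mean_curvature_vector M g x N) p = 0"
    and p: "p \<in> U"
  shows "H p = 0"
proof (rule ccontr)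
  assume Hp: "H p \<noteq> 0"
  note t = tangential(1)[OF U_points]
  obtain a :: "'b \<Rightarrow> 'e" where
    "(\<forall>i\<in>Basis. \<forall>j\<in>Basis. a i \<bullet> a j = (if i = j then 1 else 0)) \<and>
     (\<forall>i\<in>Basis. a i \<bullet> N p = 0) \<and>
     (\<forall>F :: 'a \<Rightarrow> 'e. smooth_near M p F \<longrightarrow>
      vlaplacian M g nabla F p = - (\<Sum>i\<in>Basis. der (tangential (a i)) (der (tangential (a i)) F) p))"
    using vlaplacian_frame[OF p] by (rule exE)
  then have a: "\<And>i j. i \<in> Basis \<Longrightarrow> j \<in> Basis \<Longrightarrow> a i \<bullet> a j = (if i = j then 1 else 0)"
    and an: "\<And>i. i \<in> Basis \<Longrightarrow> a i \<bullet> N p = 0"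
    and lap: "\<And>F :: 'a \<Rightarrow> 'e. smooth_near M p F \<Longrightarrow>
      vlaplacian M g nabla F p = - (\<Sum>i\<in>Basis. der (tangential (a i)) (der (tangential (a i)) F) p)"
    by blast+
  have HH: "der (tangential c) (der (tangential c) H) p = 0" for c
  proof -
    have "der (tangential c) (\<lambda>q. H q * der (tangential c) H q) p = der (tangential c) (\<lambda>q. 0) p"
      by (rule vderiv_eq_on_U[OF p t[OF p]]) (rule mean_curvature_gradient[OF rec bih _ t])
    moreover have "der (tangential c) (\<lambda>q. H q * der (tangential c) H q) p =
        H p * der (tangential c) (der (tangential c) H) p + der (tangential c) H p * der (tangential c) H p"
      by (rule vderiv_bilinear[OF bounded_bilinear_mult t[OF p] smooth_nearI[OF mean_curvature_smooth p]
            smooth_nearI[OF der_tangential_smooth[OF mean_curvature_smooth] p]])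
    moreover have "der (tangential c) H p = 0"
      using mean_curvature_gradient[OF rec bih p t[OF p], of c] Hp by simp
    ultimately show ?thesis using Hp by (simp add: vderiv_const[OF t[OF p]])
  qed
  have NN: "der (tangential c) (der (tangential c) N) p \<bullet> N p = - (der (tangential c) N p \<bullet> der (tangential c) N p)" for c
  proof -
    have "der (tangential c) (\<lambda>q. der (tangential c) N q \<bullet> N q) p = der (tangential c) (\<lambda>q. 0) p"
      by (rule vderiv_eq_on_U[OF p t[OF p]]) (rule dN_normal[OF _ t])
    then show ?thesis
      using vderiv_inner[OF t[OF p] smooth_nearI[OF der_tangential_smooth[OF N_smooth] p] N_near[OF p], of c c]
      by (simp add: vderiv_const[OF t[OF p]])
  qed
  have "0 = (\<Sum>i\<in>Basis. der (tangential (a i)) (der (tangential (a i)) (mean_curvature_vector M g x N)) p) \<bullet> N p"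
    using bih[OF p] lap[OF mean_curvature_vector_smooth_near[OF p]] by simp
  also have "\<dots> = - H p * (\<Sum>i\<in>Basis. der (tangential (a i)) N p \<bullet> der (tangential (a i)) N p)"
    by (simp add: second_derivative_mean_curvature_vector[OF p] inner_sum_left inner_add_left HH NN
        dN_normal[OF p t[OF p]] sum_distrib_left sum_negf)
  finally have "(\<Sum>i\<in>Basis. der (tangential (a i)) N p \<bullet> der (tangential (a i)) N p) = 0" using Hp by simp
  then have "der (tangential (a i)) N p = 0" if "i \<in> Basis" for i
    using that by (simp add: sum_nonneg_eq_0_iff)
  then have "real DIM('b) * H p = 0" using mean_curvature_trace_frame[OF p a an] by simp
  with Hp show False by simp
qed

end

theorem theorem3p4:
  fixes M :: "('a, 'b::euclidean_space) manifold"
    and g :: "'a metric_tensor"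
    and nabla :: "'a connection"
    and x :: "'a \<Rightarrow> 'e::euclidean_space"
  assumes "smooth_manifold M"
    and "riemannian_metric M g"
    and "levi_civita_connection M g nabla"
    and "DIM('e) = DIM('b) + 1"
    and "isometric_immersion M g x"
    and "biharmonic_hypersurface M g nabla x"
    and "recurrent_jacobi_operators M nabla"
  shows "minimal_hypersurface M g x"
  unfolding minimal_hypersurface_def
proof (intro allI impI ballI)
  fix U N p assume N: "unit_normal M x U N" and p: "p \<in> U"
  interpret hypersurface M g x nabla U N
    using assms(1,3,4,5) N by unfold_locales
  show "mean_curvature M g x N p = 0"
    using assms(6) N by (intro mean_curvature_zero[OF assms(7) _ p]) (simp add: biharmonic_hypersurface_def)
qed

end
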